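(* Let $F=\Bbbk\langle x,y\rangle$. If $D\ne0$ is a nonzero locally nilpotent $\Bbbk$-derivation of $F$, then $\mathrm{Aut}_D(F)$ contains automorphisms of arbitrarily large degree, i.e. for every integer $d\ge1$ there is $\rho\in\mathrm{Aut}_D(F)$ with $\deg(\rho)\ge d$.
   Context: $\Bbbk$ is an algebraically closed field of characteristic zero and $F=\Bbbk\langle x,y\rangle$ is the free associative unital $\Bbbk$-algebra on two generators. For a $\Bbbk$-algebra automorphism $\rho$ of $F$, $\deg(\rho)=\max\{\deg(\rho(x)),\deg(\rho(y))\}$, where $\deg$ is the usual total degree of noncommutative polynomials in $x,y$. For a $\Bbbk$-derivation $D$ of $F$, $\mathrm{Aut}_D(F)=\{\rho\in\mathrm{Aut}(F)\mid\rho D=D\rho\}$, where $\mathrm{Aut}(F)$ is the group of $\Bbbk$-algebra automorphisms; $D$ is locally nilpotent if for every $a\in F$ there is $n\ge1$ with $D^n(a)=0$. *)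

theory Defs
  imports "HOL-Library.Poly_Mapping" "HOL-Computational_Algebra.Polynomial"
begin

datatype letter = LX | LY

text \<open>
  The free monoid on two letters. It is a type of its own, written additively, because
  the convolution product of \<^theory>\<open>HOL-Library.Poly_Mapping\<close> is defined over
  \<^class>\<open>monoid_add\<close> exponents (which need not be commutative). The ring of finitely
  supported functions from words to \<open>'k\<close> is then the monoid algebra of the free monoid,
  that is, the free associative unital algebra on two generators.
\<close>

datatype fword = FWord (letters: "letter list")

instantiation fword :: monoid_add
begin

definition zero_fword :: fword where
  "0 = FWord []"

definition plus_fword :: "fword \<Rightarrow> fword \<Rightarrow> fword" where
  "u + v = FWord (letters u @ letters v)"

instance
  by intro_classes (simp_all add: zero_fword_def plus_fword_def)

end

type_synonym 'k free_alg = "fword \<Rightarrow>\<^sub>0 'k"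

definition genX :: "'k::field free_alg" where
  "genX = Poly_Mapping.single (FWord [LX]) 1"

definition genY :: "'k::field free_alg" where
  "genY = Poly_Mapping.single (FWord [LY]) 1"

definition scale :: "'k::field \<Rightarrow> 'k free_alg \<Rightarrow> 'k free_alg" where
  "scale c p = Poly_Mapping.single 0 c * p"

lemma free_alg_induct [case_names zero add]:
  fixes p :: "'k::field free_alg"
  assumes "P 0"
    and "\<And>u c q. P q \<Longrightarrow> P (Poly_Mapping.single u c + q)"
  shows "P p"
proof (induction p rule: update_induct)
  case const
  show ?case by fact
next
  case (update f a b)
  have "Poly_Mapping.update a b f = Poly_Mapping.single a b + f"
    using update(1)
    by (intro poly_mapping_eqI)
      (auto simp: lookup_update lookup_add lookup_single when_def in_keys_iff)
  then show ?case
    using assms(2) update(3) by simp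
qed

lemma lookup_scale: "Poly_Mapping.lookup (scale c p) w = c * Poly_Mapping.lookup p w"
  unfolding scale_def
proof (induction p rule: free_alg_induct)
  case zero
  then show ?case by simp
next
  case (add u a q)
  then show ?case
    by (simp add: mult_single lookup_single when_def distrib_left lookup_add)
qed

lemma vector_space_scale: "vector_space (scale :: 'k::field \<Rightarrow> _)"
  by unfold_locales
    (auto intro!: poly_mapping_eqI simp: lookup_scale lookup_add algebra_simps)

lemma scale_mult_left: "scale c (p * q) = scale c p * q"
  by (simp add: scale_def mult.assoc)

lemma scale_mult_right: "scale c (p * q) = p * scale c q"
proof -
  have "scale c p = p * Poly_Mapping.single 0 c"
    unfolding scale_def
  proof (induction p rule: free_alg_induct)
    case zero
    then show ?case by simp
  next
    case (add u a q)
    then show ?case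
      by (simp add: mult_single mult.commute distrib_left distrib_right)
  qed
  then show ?thesis
    by (simp add: scale_mult_left) (simp add: scale_def mult.assoc)
qed

lemma single_Cons:
  "Poly_Mapping.single (FWord (l # ls)) (c::'k::field) =
     (case l of LX \<Rightarrow> genX | LY \<Rightarrow> genY) * Poly_Mapping.single (FWord ls) c"
  by (cases l) (simp_all add: genX_def genY_def mult_single plus_fword_def)

definition algebra_automorphism :: "('k::field free_alg \<Rightarrow> 'k free_alg) \<Rightarrow> bool" where
  "algebra_automorphism \<rho> \<longleftrightarrow>
     Vector_Spaces.linear scale scale \<rho> \<and>
     (\<forall>p q. \<rho> (p * q) = \<rho> p * \<rho> q) \<and> \<rho> 1 = 1 \<and> bij \<rho>"

definition derivation :: "('k::field free_alg \<Rightarrow> 'k free_alg) \<Rightarrow> bool" where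
  "derivation D \<longleftrightarrow>
     Vector_Spaces.linear scale scale D \<and> (\<forall>p q. D (p * q) = D p * q + p * D q)"

definition locally_nilpotent :: "('k::field free_alg \<Rightarrow> 'k free_alg) \<Rightarrow> bool" where
  "locally_nilpotent D \<longleftrightarrow> (\<forall>a. \<exists>n\<ge>1. (D ^^ n) a = 0)"

definition Aut_D :: "('k::field free_alg \<Rightarrow> 'k free_alg) \<Rightarrow> ('k free_alg \<Rightarrow> 'k free_alg) set" where
  "Aut_D D = {\<rho>. algebra_automorphism \<rho> \<and> \<rho> \<circ> D = D \<circ> \<rho>}"

text \<open>
  Total degree, with the convention that the zero polynomial has degree \<open>0\<close>. The convention
  plays no role for automorphisms, which do not send a generator to \<open>0\<close>.
\<close>

definition total_deg :: "'k::field free_alg \<Rightarrow> nat" where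
  "total_deg p = Max (insert 0 ((\<lambda>w. length (letters w)) ` Poly_Mapping.keys p))"

definition aut_deg :: "('k::field free_alg \<Rightarrow> 'k free_alg) \<Rightarrow> nat" where
  "aut_deg \<rho> = max (total_deg (\<rho> genX)) (total_deg (\<rho> genY))"

end

theory Submission
  imports Defs
begin

text \<open>
  Every locally nilpotent derivation \<open>D\<close> of the free algebra on \<open>x\<close> and \<open>y\<close> is triangular in
  suitable coordinates: some automorphism conjugates it to a derivation \<open>E\<close> with \<open>E x = 0\<close> and
  \<open>E y\<close> a polynomial in \<open>x\<close> alone (\<open>locally_nilpotent_triangularizable\<close>, the analogue of
  Rentschler's theorem for the commutative plane). Such an \<open>E\<close> commutes with every shear
  \<open>x \<mapsto> x, y \<mapsto> y + x\<^sup>N\<close>. The shears have unbounded degree, and since degrees are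
  submultiplicative under composition, undoing the conjugation by one fixed automorphism leaves the
  degrees unbounded.

  Triangularization is read off the Newton polygon of \<open>D\<close>: the set of bidegree shifts
  \<open>(i, j)\<close> by which \<open>D\<close> moves words. The part of \<open>D\<close> of highest shift for a weight is again
  locally nilpotent (\<open>leading_part\<close>), so every vertex of the polygon carries a bihomogeneous
  locally nilpotent derivation.

  The noncommutative heart is that a nonzero one cannot have \<open>i, j \<ge> 0\<close>
  (\<open>bihomogeneous_derivation_eq_0\<close>). Let \<open>u\<close> and \<open>v\<close> be the last nonzero divided powers of \<open>D\<close>
  at \<open>x\<close> and \<open>y\<close>, attained at orders \<open>m\<close> and \<open>n\<close>. If \<open>f\<close> has bidegree \<open>(r, s)\<close>, then the
  divided power of order \<open>m r + n s\<close> sends \<open>f\<close> to \<open>f (u, v)\<close>. The bidegrees of \<open>u\<close> and \<open>v\<close> are not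
  proportional, so neither are those of their lexicographically leading words; two such words
  generate a free monoid (\<open>inj_replace_letters\<close>), whence \<open>f (u, v) \<noteq> 0\<close> for \<open>f \<noteq> 0\<close>.
  For \<open>f = D x\<close> this says that \<open>x\<close> survives more than \<open>m\<close> applications of \<open>D\<close>.

  So all vertices have \<open>i = -1\<close> (a multiple of \<open>y\<^sup>m\<close> in \<open>D x\<close>) or \<open>j = -1\<close> (a multiple of
  \<open>x\<^sup>n\<close> in \<open>D y\<close>). If only one kind occurs, then \<open>D\<close> is triangular, up to exchanging \<open>x\<close> and
  \<open>y\<close>. Otherwise the polygon lies on or below the segment from \<open>(-1, m)\<close> to \<open>(n, -1)\<close>
  (\<open>newton_triangle\<close>); say \<open>m \<le> n\<close>. Then \<open>m + 1\<close> divides \<open>n + 1\<close>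
  (\<open>newton_triangle_divisibility\<close>), because otherwise, for the part on this segment, every word of
  the image of \<open>x\<close> contains \<open>y\<close> and conversely, and then along a polynomial integral curve
  \<open>(X, Y)\<close> of the induced commutative vector field \<open>Y\<close> divides \<open>X'\<close> and \<open>X\<close> divides \<open>Y'\<close>,
  which is impossible for reasons of degree. With \<open>k = (n + 1) / (m + 1)\<close>, a shear
  \<open>y \<mapsto> y + c x\<^sup>k\<close> with \<open>c\<close> a root of a nonconstant polynomial lowers \<open>n\<close> and keeps \<open>m\<close>
  (\<open>shear_reduces_x_poly\<close>), and induction finishes the argument.
\<close>

section \<open>Homomorphisms and derivations\<close>

lemma linear_scale_iff:
  "Vector_Spaces.linear scale scale T \<longleftrightarrow>
     (\<forall>p q. T (p + q) = T p + T q) \<and> (\<forall>c p. T (scale c p) = scale c (T p))"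
  for T :: "'k::field free_alg \<Rightarrow> 'k free_alg"
  using vector_space_scale
  by (auto simp: Vector_Spaces.linear_def module_hom_def module_hom_axioms_def
      module_iff_vector_space)

lemma single_eq_scale: "Poly_Mapping.single w (c::'k::field) = scale c (Poly_Mapping.single w 1)"
  by (simp add: scale_def mult_single)

lemma scale_0_right [simp]: "scale c 0 = 0"
  and scale_0_left [simp]: "scale 0 p = 0"
  and scale_1 [simp]: "scale 1 p = p"
  and scale_scale [simp]: "scale c (scale d p) = scale (c * d) p"
  by (auto intro!: poly_mapping_eqI simp: lookup_scale mult.assoc)

lemma scale_add: "scale c (p + q) = scale c p + scale c q"
  by (simp add: scale_def distrib_left)

lemma scale_diff: "scale c (p - q) = scale c p - scale c q"
  by (simp add: scale_def right_diff_distrib)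

lemma scale_eq_0_iff [simp]: "scale c p = 0 \<longleftrightarrow> c = 0 \<or> p = 0"
  by (auto simp: poly_mapping_eq_iff fun_eq_iff lookup_scale)

lemma linear_eqI_words:
  fixes S T :: "'k::field free_alg \<Rightarrow> 'k free_alg"
  assumes "Vector_Spaces.linear scale scale S" "Vector_Spaces.linear scale scale T"
    and "\<And>w. S (Poly_Mapping.single w 1) = T (Poly_Mapping.single w 1)"
  shows "S = T"
proof
  fix p
  have zero: "S 0 = 0" "T 0 = 0"
    using assms(1,2) unfolding linear_scale_iff by (metis add_cancel_left_left)+
  show "S p = T p"
  proof (induction p rule: free_alg_induct)
    case (add w c p)
    have "S (Poly_Mapping.single w c) = T (Poly_Mapping.single w c)"
      using assms by (subst (1 2) single_eq_scale) (simp add: linear_scale_iff)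
    with add assms show ?case by (simp add: linear_scale_iff)
  qed (simp add: zero)
qed

lemma single_letter_add:
  "Poly_Mapping.single (FWord [LX] + w) (1::'k::field) = genX * Poly_Mapping.single w 1"
  "Poly_Mapping.single (FWord [LY] + w) (1::'k::field) = genY * Poly_Mapping.single w 1"
  by (simp_all add: genX_def genY_def mult_single)

lemma fword_induct [case_names empty LX LY]:
  assumes "P 0" "\<And>w. P w \<Longrightarrow> P (FWord [LX] + w)" "\<And>w. P w \<Longrightarrow> P (FWord [LY] + w)"
  shows "P w"
proof -
  have "P (FWord ls)" for ls
  proof (induction ls)
    case Nil
    show ?case using assms(1) by (simp add: zero_fword_def)
  next
    case (Cons l ls)
    then show ?case
      using assms(2)[of "FWord ls"] assms(3)[of "FWord ls"]
      by (cases l) (auto simp: plus_fword_def)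
  qed
  then show ?thesis by (cases w) simp
qed

text \<open>
  Homomorphisms and derivations are determined by values on words. The target ring is arbitrary, with
  scalars embedded by a central \<open>\<iota>\<close>, because three targets occur: the free algebra itself, polynomials
  in one variable (restriction to a curve) and the field (evaluation at a point).
\<close>

definition extend :: "('k::field \<Rightarrow> 'r::ring_1) \<Rightarrow> (fword \<Rightarrow> 'r) \<Rightarrow> 'k free_alg \<Rightarrow> 'r" where
  "extend \<iota> \<phi> p = (\<Sum>w\<in>Poly_Mapping.keys p. \<iota> (Poly_Mapping.lookup p w) * \<phi> w)"

locale scalar_embedding =
  fixes \<iota> :: "'k::field \<Rightarrow> 'r::ring_1"
  assumes add: "\<iota> (c + d) = \<iota> c + \<iota> d"
    and mult: "\<iota> (c * d) = \<iota> c * \<iota> d"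
    and one: "\<iota> 1 = 1"
    and central: "\<iota> c * r = r * \<iota> c"
begin

lemma zero: "\<iota> 0 = 0"
  by (metis add add_cancel_left_left)

lemma extend_alt:
  assumes "finite A" "Poly_Mapping.keys p \<subseteq> A"
  shows "extend \<iota> \<phi> p = (\<Sum>w\<in>A. \<iota> (Poly_Mapping.lookup p w) * \<phi> w)"
  unfolding extend_def using assms
  by (intro sum.mono_neutral_left) (auto simp: in_keys_iff zero)

lemma extend_add: "extend \<iota> \<phi> (p + q) = extend \<iota> \<phi> p + extend \<iota> \<phi> q"
proof -
  let ?A = "Poly_Mapping.keys p \<union> Poly_Mapping.keys q"
  have "extend \<iota> \<phi> r = (\<Sum>w\<in>?A. \<iota> (Poly_Mapping.lookup r w) * \<phi> w)"
    if "r \<in> {p, q, p + q}" for r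
    using that Poly_Mapping.keys_add[of p q] by (intro extend_alt) auto
  then show ?thesis
    by (simp add: lookup_add add distrib_right sum.distrib)
qed

lemma extend_0: "extend \<iota> \<phi> 0 = 0"
  by (simp add: extend_def)

lemma extend_single: "extend \<iota> \<phi> (Poly_Mapping.single w c) = \<iota> c * \<phi> w"
  by (subst extend_alt[of "{w}"]) auto

lemma extend_scale: "extend \<iota> \<phi> (scale c p) = \<iota> c * extend \<iota> \<phi> p"
proof -
  have "Poly_Mapping.keys (scale c p) \<subseteq> Poly_Mapping.keys p"
    by (auto simp: in_keys_iff lookup_scale)
  then show ?thesis
    by (subst extend_alt[of "Poly_Mapping.keys p"])
      (auto simp: extend_def lookup_scale mult sum_distrib_left mult.assoc)
qed

end

definition word_eval :: "'r \<Rightarrow> 'r \<Rightarrow> fword \<Rightarrow> 'r::ring_1" where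
  "word_eval P Q w = prod_list (map (case_letter P Q) (letters w))"

lemma word_eval_add: "word_eval P Q (u + v) = word_eval P Q u * word_eval P Q v"
  by (simp add: word_eval_def plus_fword_def)

lemma word_eval_simps [simp]:
  "word_eval P Q 0 = 1" "word_eval P Q (FWord []) = 1"
  "word_eval P Q (FWord [LX]) = P" "word_eval P Q (FWord [LY]) = Q"
  by (simp_all add: word_eval_def zero_fword_def)

definition subst :: "('k::field \<Rightarrow> 'r::ring_1) \<Rightarrow> 'r \<Rightarrow> 'r \<Rightarrow> 'k free_alg \<Rightarrow> 'r" where
  "subst \<iota> P Q = extend \<iota> (word_eval P Q)"

context scalar_embedding
begin

lemma subst_linear:
  "subst \<iota> P Q (p + q) = subst \<iota> P Q p + subst \<iota> P Q q"
  "subst \<iota> P Q (scale c p) = \<iota> c * subst \<iota> P Q p"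
  "subst \<iota> P Q (Poly_Mapping.single w c) = \<iota> c * word_eval P Q w"
  "subst \<iota> P Q 0 = 0"
  by (simp_all add: subst_def extend_add extend_scale extend_single extend_0)

lemma subst_gen [simp]: "subst \<iota> P Q genX = P" "subst \<iota> P Q genY = Q" "subst \<iota> P Q 1 = 1"
proof -
  show "subst \<iota> P Q genX = P" "subst \<iota> P Q genY = Q"
    by (simp_all add: genX_def genY_def subst_linear one)
  have "subst \<iota> P Q (Poly_Mapping.single 0 1) = 1"
    by (subst subst_linear(3)) (simp add: one)
  then show "subst \<iota> P Q 1 = 1" by simp
qed

lemma subst_mult: "subst \<iota> P Q (p * q) = subst \<iota> P Q p * subst \<iota> P Q q"
proof (induction p rule: free_alg_induct)
  case zero
  then show ?case by (simp add: subst_linear)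
next
  case (add u c p)
  have "subst \<iota> P Q (Poly_Mapping.single u c * q) =
      subst \<iota> P Q (Poly_Mapping.single u c) * subst \<iota> P Q q"
  proof (induction q rule: free_alg_induct)
    case zero
    then show ?case by (simp add: subst_linear)
  next
    case (add v d q)
    have "\<iota> (c * d) * (word_eval P Q u * word_eval P Q v) =
        \<iota> c * word_eval P Q u * (\<iota> d * word_eval P Q v)"
      by (metis central mult mult.assoc)
    with add show ?case
      by (simp add: distrib_left subst_linear mult_single word_eval_add)
  qed
  with add show ?case by (simp add: distrib_right subst_linear)
qed

end

lemma scale_central:
  fixes p :: "'k::field free_alg"
  shows "Poly_Mapping.single 0 c * p = p * Poly_Mapping.single 0 c"
  using scale_mult_right[of c p 1] by (simp add: scale_def)

global_interpretation self: scalar_embedding "Poly_Mapping.single (0::fword) :: 'k::field \<Rightarrow> 'k free_alg"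
  by unfold_locales (simp_all add: single_add mult_single, rule scale_central)

global_interpretation pol: scalar_embedding "\<lambda>c::'k::field. [:c:]"
  by unfold_locales (simp_all add: mult.commute one_pCons)

definition algebra_endo :: "('k::field free_alg \<Rightarrow> 'k free_alg) \<Rightarrow> bool" where
  "algebra_endo \<rho> \<longleftrightarrow> Vector_Spaces.linear scale scale \<rho> \<and>
     (\<forall>p q. \<rho> (p * q) = \<rho> p * \<rho> q) \<and> \<rho> 1 = 1"

lemma algebra_endoD:
  assumes "algebra_endo \<rho>"
  shows "\<rho> (p + q) = \<rho> p + \<rho> q" "\<rho> (scale c p) = scale c (\<rho> p)" "\<rho> (p * q) = \<rho> p * \<rho> q"
    "\<rho> 1 = 1" "\<rho> 0 = 0" "\<rho> (p ^ n) = \<rho> p ^ n"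
proof -
  show basic: "\<rho> (p + q) = \<rho> p + \<rho> q" "\<rho> (scale c p) = scale c (\<rho> p)"
    "\<rho> (p * q) = \<rho> p * \<rho> q" "\<rho> 1 = 1" for p q c
    using assms by (auto simp: algebra_endo_def linear_scale_iff)
  show "\<rho> 0 = 0" using basic(1)[of 0 0] by simp
  show "\<rho> (p ^ n) = \<rho> p ^ n" by (induction n) (simp_all add: basic)
qed

abbreviation subst_gens :: "'k::field free_alg \<Rightarrow> 'k free_alg \<Rightarrow> 'k free_alg \<Rightarrow> 'k free_alg" where
  "subst_gens \<equiv> subst (Poly_Mapping.single 0)"

lemma algebra_endo_subst: "algebra_endo (subst_gens P Q)"
  unfolding algebra_endo_def linear_scale_iff
  by (simp add: self.subst_linear self.subst_mult) (simp add: scale_def)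

lemma algebra_endo_eqI:
  assumes "algebra_endo \<rho>" "algebra_endo \<sigma>" "\<rho> genX = \<sigma> genX" "\<rho> genY = \<sigma> genY"
  shows "\<rho> = \<sigma>"
proof (rule linear_eqI_words)
  fix w
  show "\<rho> (Poly_Mapping.single w 1) = \<sigma> (Poly_Mapping.single w 1)"
    by (induction w rule: fword_induct)
      (simp_all add: assms single_letter_add algebra_endoD[OF assms(1)] algebra_endoD[OF assms(2)])
qed (use assms in \<open>auto simp: algebra_endo_def\<close>)

lemma algebra_endo_comp: "algebra_endo \<rho> \<Longrightarrow> algebra_endo \<sigma> \<Longrightarrow> algebra_endo (\<rho> \<circ> \<sigma>)"
  by (auto simp: algebra_endo_def linear_scale_iff)

lemma algebra_endo_id: "algebra_endo id"
  by (auto simp: algebra_endo_def linear_scale_iff)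

lemma algebra_automorphism_iff: "algebra_automorphism \<rho> \<longleftrightarrow> algebra_endo \<rho> \<and> bij \<rho>"
  by (auto simp: algebra_automorphism_def algebra_endo_def)

lemma algebra_automorphismI:
  assumes "algebra_endo \<rho>" "algebra_endo \<sigma>"
    and "\<rho> (\<sigma> genX) = genX" "\<rho> (\<sigma> genY) = genY" "\<sigma> (\<rho> genX) = genX" "\<sigma> (\<rho> genY) = genY"
  shows "algebra_automorphism \<rho>" "inv \<rho> = \<sigma>"
proof -
  have 1: "\<rho> \<circ> \<sigma> = id" and 2: "\<sigma> \<circ> \<rho> = id"
    using assms by (auto intro!: algebra_endo_eqI algebra_endo_comp algebra_endo_id)
  show "algebra_automorphism \<rho>"
    using 1 2 assms(1) by (auto simp: algebra_automorphism_iff intro: o_bij)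
  show "inv \<rho> = \<sigma>" using 1 2 by (rule inv_unique_comp)
qed

lemma algebra_automorphism_inv:
  assumes "algebra_automorphism \<rho>"
  shows "algebra_automorphism (inv \<rho>)"
proof -
  have bij: "bij \<rho>" and endo: "algebra_endo \<rho>" using assms by (auto simp: algebra_automorphism_iff)
  have [simp]: "inv \<rho> (\<rho> p) = p" "\<rho> (inv \<rho> p) = p" for p
    using bij by (simp_all add: bij_is_inj bij_is_surj surj_f_inv_f)
  have inj: "p = q" if "\<rho> p = \<rho> q" for p q
    using bij that by (simp add: bij_is_inj inj_eq)
  have "algebra_endo (inv \<rho>)"
    unfolding algebra_endo_def linear_scale_iff
    by (safe; rule inj) (simp_all add: algebra_endoD[OF endo])
  with bij show ?thesis by (simp add: algebra_automorphism_iff bij_imp_bij_inv)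
qed

lemma algebra_automorphism_cancel:
  assumes "algebra_automorphism \<rho>"
  shows "\<rho> \<circ> inv \<rho> = id" "inv \<rho> \<circ> \<rho> = id"
  using assms by (simp_all add: algebra_automorphism_iff bij_is_inj flip: surj_iff)
    (simp add: bij_is_surj)

lemma algebra_automorphism_comp:
  "algebra_automorphism \<rho> \<Longrightarrow> algebra_automorphism \<sigma> \<Longrightarrow> algebra_automorphism (\<rho> \<circ> \<sigma>)"
  by (simp add: algebra_automorphism_iff algebra_endo_comp bij_comp)

lemma derivationD:
  assumes "derivation D"
  shows "D (p + q) = D p + D q" "D (scale c p) = scale c (D p)" "D (p * q) = D p * q + p * D q"
    "D 0 = 0" "D 1 = 0" "D (p - q) = D p - D q" "D (sum f A) = (\<Sum>a\<in>A. D (f a))"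
proof -
  show basic: "D (p + q) = D p + D q" "D (scale c p) = scale c (D p)"
    "D (p * q) = D p * q + p * D q" for p q c
    using assms by (auto simp: derivation_def linear_scale_iff)
  show zero: "D 0 = 0" using basic(1)[of 0 0] by simp
  show "D 1 = 0" using basic(3)[of 1 1] by simp
  show "D (p - q) = D p - D q" by (metis basic(1) diff_add_cancel add_diff_cancel_right')
  show "D (sum f A) = (\<Sum>a\<in>A. D (f a))"
    by (induction A rule: infinite_finite_induct) (simp_all add: basic zero)
qed

lemma derivation_eqI:
  assumes "derivation D" "derivation E" "D genX = E genX" "D genY = E genY"
  shows "D = E"
proof (rule linear_eqI_words)
  fix w
  show "D (Poly_Mapping.single w 1) = E (Poly_Mapping.single w 1)"
    by (induction w rule: fword_induct)
      (simp_all add: assms single_letter_add derivationD[OF assms(1)] derivationD[OF assms(2)])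
qed (use assms in \<open>auto simp: derivation_def\<close>)

lemma derivation_zero: "derivation (\<lambda>_. 0)"
  by (simp add: derivation_def linear_scale_iff)

lemma derivation_diff: "derivation D \<Longrightarrow> derivation E \<Longrightarrow> derivation (\<lambda>p. D p - E p)"
  unfolding derivation_def linear_scale_iff
  by (intro conjI allI) (simp_all add: scale_diff left_diff_distrib right_diff_distrib)

text \<open>
  The recursion is the Leibniz rule applied to the first letter, for the derivation with values \<open>a\<close>
  at \<open>x\<close> and \<open>b\<close> at \<open>y\<close>.
\<close>

primrec word_deriv :: "'k::field free_alg \<Rightarrow> 'k free_alg \<Rightarrow> letter list \<Rightarrow> 'k free_alg" where
  "word_deriv a b [] = 0"
| "word_deriv a b (l # ls) = (case l of LX \<Rightarrow> a | LY \<Rightarrow> b) * Poly_Mapping.single (FWord ls) 1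
     + (case l of LX \<Rightarrow> genX | LY \<Rightarrow> genY) * word_deriv a b ls"

lemma word_deriv_append:
  "word_deriv a b (us @ vs) = word_deriv a b us * Poly_Mapping.single (FWord vs) 1
     + Poly_Mapping.single (FWord us) 1 * word_deriv a b vs"
proof (induction us)
  case Nil
  have "Poly_Mapping.single (FWord []) 1 = (1 :: 'a free_alg)"
    by (metis zero_fword_def single_one)
  then show ?case by simp
next
  case (Cons l us)
  have "Poly_Mapping.single (FWord (us @ vs)) (1::'a) =
      Poly_Mapping.single (FWord us) 1 * Poly_Mapping.single (FWord vs) 1"
    by (simp add: mult_single plus_fword_def)
  with Cons show ?case by (simp add: single_Cons[of l us 1] algebra_simps)
qed

text \<open>
  The free algebra is free for derivations as well: the values at the generators can be prescribed.
\<close>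

lemma derivation_with_values:
  fixes a b :: "'k::field free_alg"
  obtains D where "derivation D" "D genX = a" "D genY = b"
proof -
  define D where "D = extend (Poly_Mapping.single 0) (word_deriv a b \<circ> letters)"
  have lin: "D (p + q) = D p + D q" "D (Poly_Mapping.single w c) = scale c (word_deriv a b (letters w))"
    "D 0 = 0" "D (scale c p) = scale c (D p)" for p q w c
    by (simp_all add: D_def self.extend_add self.extend_single self.extend_scale self.extend_0)
      (simp_all add: scale_def)
  have "D (p * q) = D p * q + p * D q" for p q
  proof (induction p rule: free_alg_induct)
    case zero
    then show ?case by (simp add: lin)
  next
    case (add u c p)
    have "D (Poly_Mapping.single u c * q) =
        D (Poly_Mapping.single u c) * q + Poly_Mapping.single u c * D q"
    proof (induction q rule: free_alg_induct)
      case zero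
      then show ?case by (simp add: lin)
    next
      case (add v d q)
      have "D (Poly_Mapping.single u c * Poly_Mapping.single v d) =
        D (Poly_Mapping.single u c) * Poly_Mapping.single v d + Poly_Mapping.single u c * D (Poly_Mapping.single v d)"
      proof -
        have "letters (u + v) = letters u @ letters v" by (simp add: plus_fword_def)
        then have "D (Poly_Mapping.single u c * Poly_Mapping.single v d) = scale (c * d)
            (word_deriv a b (letters u) * Poly_Mapping.single v 1 +
             Poly_Mapping.single u 1 * word_deriv a b (letters v))"
          by (simp add: mult_single lin(2) word_deriv_append)
        moreover have "Poly_Mapping.single u c = scale c (Poly_Mapping.single u 1)"
          "Poly_Mapping.single v d = scale d (Poly_Mapping.single v 1)"
          by (rule single_eq_scale)+
        ultimately show ?thesis
          by (simp only: lin(2)[of _ 1] lin(4) scale_mult_left[symmetric]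
              scale_mult_right[symmetric] scale_scale scale_add scale_1 mult.commute)
      qed
      with add show ?case by (simp only: distrib_left lin(1) add_ac)
    qed
    with add show ?case by (simp only: distrib_right lin(1) add_ac)
  qed
  then have "derivation D" by (simp add: derivation_def linear_scale_iff lin)
  moreover have "D genX = a" "D genY = b"
    by (simp_all add: genX_def genY_def lin flip: zero_fword_def)
  ultimately show thesis by (rule that)
qed

lemma derivation_conj:
  assumes "algebra_automorphism \<rho>" "derivation D"
  shows "derivation (inv \<rho> \<circ> D \<circ> \<rho>)"
proof -
  have [simp]: "inv \<rho> (\<rho> p) = p" for p
    using assms(1) by (simp add: algebra_automorphism_iff bij_is_inj)
  have endo: "algebra_endo \<rho>" "algebra_endo (inv \<rho>)"
    using assms(1) algebra_automorphism_inv algebra_automorphism_iff by blast+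
  show ?thesis
    unfolding derivation_def linear_scale_iff
    by (simp add: derivationD[OF assms(2)] algebra_endoD[OF endo(1)] algebra_endoD[OF endo(2)])
qed

section \<open>Supports and gradings\<close>

definition words_in :: "(fword \<Rightarrow> bool) \<Rightarrow> 'k::field free_alg \<Rightarrow> bool" where
  "words_in Q p \<longleftrightarrow> (\<forall>w\<in>Poly_Mapping.keys p. Q w)"

lemma words_in_mono: "words_in Q p \<Longrightarrow> (\<And>w. Q w \<Longrightarrow> R w) \<Longrightarrow> words_in R p"
  by (auto simp: words_in_def)

lemma words_in_0 [simp]: "words_in Q 0"
  by (simp add: words_in_def)

lemma words_in_single: "words_in Q (Poly_Mapping.single w c) \<longleftrightarrow> c = 0 \<or> Q w"
  by (simp add: words_in_def)

lemma words_in_add: "words_in Q p \<Longrightarrow> words_in Q q \<Longrightarrow> words_in Q (p + q)"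
  using Poly_Mapping.keys_add[of p q] by (auto simp: words_in_def)

lemma words_in_diff: "words_in Q p \<Longrightarrow> words_in Q q \<Longrightarrow> words_in Q (p - q)"
  by (auto simp: words_in_def in_keys_iff lookup_minus)

lemma words_in_sum: "(\<And>a. a \<in> A \<Longrightarrow> words_in Q (f a)) \<Longrightarrow> words_in Q (sum f A)"
  by (induction A rule: infinite_finite_induct) (auto intro: words_in_add)

lemma words_in_scale: "words_in Q p \<Longrightarrow> words_in Q (scale c p)"
  by (auto simp: words_in_def in_keys_iff lookup_scale)

lemma words_in_mult:
  assumes "words_in Q p" "words_in R q" "\<And>u v. Q u \<Longrightarrow> R v \<Longrightarrow> S (u + v)"
  shows "words_in S (p * q)"
  using Poly_Mapping.keys_mult[of p q] assms unfolding words_in_def by blast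

lemma words_in_contradictory:
  assumes "words_in Q p" "words_in R p" "\<And>w. Q w \<Longrightarrow> \<not> R w"
  shows "p = 0"
  using assms unfolding words_in_def by (metis keys_eq_empty ex_in_conv)

lemma sum_words: "(\<Sum>w\<in>Poly_Mapping.keys p. scale (Poly_Mapping.lookup p w) (Poly_Mapping.single w 1)) = p"
  for p :: "'k::field free_alg"
proof (rule poly_mapping_eqI)
  fix v
  have "Poly_Mapping.lookup (\<Sum>w\<in>Poly_Mapping.keys p.
        scale (Poly_Mapping.lookup p w) (Poly_Mapping.single w 1)) v =
      (\<Sum>w\<in>Poly_Mapping.keys p. if w = v then Poly_Mapping.lookup p v else 0)"
    unfolding lookup_sum
    by (intro sum.cong) (auto simp: lookup_scale lookup_single)
  also have "\<dots> = Poly_Mapping.lookup p v"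
    by (simp add: in_keys_iff)
  finally show "Poly_Mapping.lookup (\<Sum>w\<in>Poly_Mapping.keys p.
        scale (Poly_Mapping.lookup p w) (Poly_Mapping.single w 1)) v = Poly_Mapping.lookup p v" .
qed

definition part :: "(fword \<Rightarrow> bool) \<Rightarrow> 'k::field free_alg \<Rightarrow> 'k free_alg" where
  "part Q p = (\<Sum>w\<in>{w \<in> Poly_Mapping.keys p. Q w}. Poly_Mapping.single w (Poly_Mapping.lookup p w))"

lemma lookup_part: "Poly_Mapping.lookup (part Q p) w = (if Q w then Poly_Mapping.lookup p w else 0)"
proof -
  have "Poly_Mapping.lookup (part Q p) w =
      (\<Sum>v\<in>{v \<in> Poly_Mapping.keys p. Q v}. if v = w then Poly_Mapping.lookup p w else 0)"
    unfolding part_def lookup_sum by (intro sum.cong) (auto simp: lookup_single)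
  also have "\<dots> = (if Q w then Poly_Mapping.lookup p w else 0)"
    by (simp add: in_keys_iff)
  finally show ?thesis .
qed

definition degX :: "fword \<Rightarrow> nat" where "degX w = count_list (letters w) LX"
definition degY :: "fword \<Rightarrow> nat" where "degY w = count_list (letters w) LY"

lemma degXY_simps [simp]:
  "degX 0 = 0" "degX (u + v) = degX u + degX v" "degX (FWord []) = 0"
  "degX (FWord [LX]) = 1" "degX (FWord [LY]) = 0"
  "degY 0 = 0" "degY (u + v) = degY u + degY v" "degY (FWord []) = 0"
  "degY (FWord [LX]) = 0" "degY (FWord [LY]) = 1"
  by (simp_all add: degX_def degY_def zero_fword_def plus_fword_def)

lemma length_letters: "length (letters w) = degX w + degY w"
  by (induction w rule: fword_induct) (auto simp: plus_fword_def zero_fword_def degX_def degY_def)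

text \<open>
  A derivation that moves the generators by at most (or by exactly) \<open>d\<close> in weight does so to every
  element, since the Leibniz rule changes one letter of a word at a time. Treating both relations at
  once serves homogeneous derivations and the lower order terms of arbitrary ones.
\<close>

lemma derivation_shifts_support:
  fixes W :: "fword \<Rightarrow> int"
  assumes D: "derivation D"
    and W: "\<And>u v. W (u + v) = W u + W v"
    and R: "R = (\<le>) \<or> R = (=)"
    and X: "words_in (\<lambda>w. R (W w) (W (FWord [LX]) + d)) (D genX)"
    and Y: "words_in (\<lambda>w. R (W w) (W (FWord [LY]) + d)) (D genY)"
    and p: "words_in (\<lambda>w. R (W w) n) p"
  shows "words_in (\<lambda>w. R (W w) (n + d)) (D p)"
proof -
  have R_refl: "R m m" and R_add: "R i j \<Longrightarrow> R m k \<Longrightarrow> R (i + m) (j + k)"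
    and R_trans: "R i (m + d) \<Longrightarrow> R m j \<Longrightarrow> R i (j + d)" for i j m k
    using R by auto
  have word: "words_in (\<lambda>w. R (W w) (W u + d)) (D (Poly_Mapping.single u 1))" for u
  proof (induction u rule: fword_induct)
    case empty
    then show ?case using derivationD(5)[OF D] by simp
  next
    case (LX u)
    have "words_in (\<lambda>w. R (W w) (W (FWord [LX] + u) + d)) (D genX * Poly_Mapping.single u 1)"
      by (rule words_in_mult[OF X, of "\<lambda>w. w = u"])
        (use R_add[OF _ R_refl] in \<open>force simp: words_in_single W algebra_simps\<close>)+
    moreover have "words_in (\<lambda>w. R (W w) (W (FWord [LX] + u) + d)) (genX * D (Poly_Mapping.single u 1))"
      unfolding genX_def
      by (rule words_in_mult[OF _ LX, of "\<lambda>w. w = FWord [LX]"])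
        (use R_add[OF R_refl] in \<open>force simp: words_in_single W algebra_simps\<close>)+
    ultimately show ?case
      by (simp add: single_letter_add derivationD[OF D] words_in_add)
  next
    case (LY u)
    have "words_in (\<lambda>w. R (W w) (W (FWord [LY] + u) + d)) (D genY * Poly_Mapping.single u 1)"
      by (rule words_in_mult[OF Y, of "\<lambda>w. w = u"])
        (use R_add[OF _ R_refl] in \<open>force simp: words_in_single W algebra_simps\<close>)+
    moreover have "words_in (\<lambda>w. R (W w) (W (FWord [LY] + u) + d)) (genY * D (Poly_Mapping.single u 1))"
      unfolding genY_def
      by (rule words_in_mult[OF _ LY, of "\<lambda>w. w = FWord [LY]"])
        (use R_add[OF R_refl] in \<open>force simp: words_in_single W algebra_simps\<close>)+
    ultimately show ?case
      by (simp add: single_letter_add derivationD[OF D] words_in_add)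
  qed
  have "D p = (\<Sum>u\<in>Poly_Mapping.keys p. scale (Poly_Mapping.lookup p u) (D (Poly_Mapping.single u 1)))"
    by (subst sum_words[of p, symmetric]) (simp add: derivationD(2,7)[OF D])
  moreover have "words_in (\<lambda>w. R (W w) (n + d)) (D (Poly_Mapping.single u 1))"
    if "u \<in> Poly_Mapping.keys p" for u
    by (rule words_in_mono[OF word]) (use p that in \<open>auto simp: words_in_def intro: R_trans\<close>)
  ultimately show ?thesis
    by (simp add: words_in_sum words_in_scale)
qed

section \<open>Iterates and divided powers\<close>

lemma funpow_derivation:
  assumes "derivation D"
  shows "(D ^^ n) (p + q) = (D ^^ n) p + (D ^^ n) q" "(D ^^ n) (scale c p) = scale c ((D ^^ n) p)"
    "(D ^^ n) 0 = 0" "(D ^^ n) (p - q) = (D ^^ n) p - (D ^^ n) q"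
    "(D ^^ n) (sum f A) = (\<Sum>a\<in>A. (D ^^ n) (f a))"
  by (induction n) (simp_all add: derivationD[OF assms])

lemma funpow_eq_0_mono:
  assumes "derivation D" "(D ^^ n) p = 0" "n \<le> m"
  shows "(D ^^ m) p = 0"
proof -
  have "(D ^^ m) p = (D ^^ (m - n)) ((D ^^ n) p)"
    using assms(3) by (metis comp_apply funpow_add le_add_diff_inverse2)
  with assms(1,2) show ?thesis by (simp add: funpow_derivation)
qed

lemma locally_nilpotentI_words:
  fixes D :: "'k::field free_alg \<Rightarrow> 'k free_alg"
  assumes D: "derivation D" and words: "\<And>w. \<exists>n. (D ^^ n) (Poly_Mapping.single w 1) = 0"
  shows "locally_nilpotent D"
  unfolding locally_nilpotent_def
proof
  fix p :: "'k free_alg"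
  obtain n where n: "(D ^^ n w) (Poly_Mapping.single w 1) = 0" for w
    using words by metis
  define N where "N = Suc (Max (n ` Poly_Mapping.keys p))"
  have "(D ^^ N) (Poly_Mapping.single w 1) = 0" if "w \<in> Poly_Mapping.keys p" for w
    by (rule funpow_eq_0_mono[OF D n]) (use that in \<open>auto simp: N_def le_SucI\<close>)
  then have "(D ^^ N) p = 0"
    by (subst sum_words[symmetric]) (simp add: funpow_derivation[OF D])
  then show "\<exists>n\<ge>1. (D ^^ n) p = 0"
    by (intro exI[of _ N]) (simp add: N_def)
qed

lemma locally_nilpotent_conj:
  assumes "algebra_automorphism \<rho>" "locally_nilpotent D"
  shows "locally_nilpotent (inv \<rho> \<circ> D \<circ> \<rho>)"
proof -
  have bij: "bij \<rho>" using assms(1) by (simp add: algebra_automorphism_iff)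
  have "((inv \<rho> \<circ> D \<circ> \<rho>) ^^ n) p = inv \<rho> ((D ^^ n) (\<rho> p))" for n p
    by (induction n) (use bij in \<open>simp_all add: bij_is_inj bij_is_surj surj_f_inv_f\<close>)
  moreover have "inv \<rho> 0 = 0"
    using algebra_automorphism_inv[OF assms(1)] by (simp add: algebra_automorphism_iff algebra_endoD)
  ultimately show ?thesis
    using assms(2) unfolding locally_nilpotent_def by metis
qed

text \<open>
  Dividing by the factorial removes the binomial coefficients from the Leibniz formula, so that divided
  powers behave like the coefficients of a multiplicative generating function.
\<close>

definition divided_power :: "('k::field_char_0 free_alg \<Rightarrow> 'k free_alg) \<Rightarrow> nat \<Rightarrow> 'k free_alg \<Rightarrow> 'k free_alg" where
  "divided_power D n p = scale (inverse (fact n)) ((D ^^ n) p)"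

lemma divided_power_linear:
  assumes "derivation D"
  shows "divided_power D n (p + q) = divided_power D n p + divided_power D n q"
    "divided_power D n (scale c p) = scale c (divided_power D n p)"
    "divided_power D n 0 = 0"
    "divided_power D n (sum f A) = (\<Sum>a\<in>A. divided_power D n (f a))"
proof -
  show 1: "divided_power D n (p + q) = divided_power D n p + divided_power D n q"
    "divided_power D n 0 = 0" for p q
    by (simp_all add: divided_power_def funpow_derivation[OF assms] scale_add)
  show "divided_power D n (scale c p) = scale c (divided_power D n p)"
    by (simp add: divided_power_def funpow_derivation[OF assms] mult.commute)
  show "divided_power D n (sum f A) = (\<Sum>a\<in>A. divided_power D n (f a))"
    by (induction A rule: infinite_finite_induct) (simp_all add: 1)
qed

lemma divided_power_eq_0_iff: "divided_power D n p = 0 \<longleftrightarrow> (D ^^ n) p = 0"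
  by (simp add: divided_power_def)

lemma divided_power_simps:
  assumes "derivation D"
  shows "divided_power D 0 p = p"
    "D (divided_power D n p) = scale (of_nat (Suc n)) (divided_power D (Suc n) p)"
    "divided_power D n (D p) = scale (of_nat (Suc n)) (divided_power D (Suc n) p)"
proof -
  show "divided_power D 0 p = p" by (simp add: divided_power_def)
  show *: "D (divided_power D n p) = scale (of_nat (Suc n)) (divided_power D (Suc n) p)"
    by (simp add: divided_power_def derivationD[OF assms] field_simps del: of_nat_Suc)
  show "divided_power D n (D p) = scale (of_nat (Suc n)) (divided_power D (Suc n) p)"
    unfolding *[symmetric] by (simp add: divided_power_def derivationD[OF assms] funpow_swap1)
qed

lemma divided_power_mult:
  assumes D: "derivation D"
  shows "divided_power D n (p * q) = (\<Sum>i\<le>n. divided_power D i p * divided_power D (n - i) q)"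
proof (induction n)
  case 0
  show ?case by (simp add: divided_power_simps[OF D])
next
  case (Suc n)
  let ?d = "divided_power D"
  have "scale (of_nat (Suc n)) (?d (Suc n) (p * q)) =
      (\<Sum>i\<le>n. D (?d i p * ?d (n - i) q))"
    by (simp only: divided_power_simps(2)[OF D, symmetric] Suc derivationD(7)[OF D])
  also have "\<dots> = (\<Sum>i\<le>n. scale (of_nat (Suc i)) (?d (Suc i) p * ?d (n - i) q))
      + (\<Sum>i\<le>n. scale (of_nat (Suc n - i)) (?d i p * ?d (Suc n - i) q))"
    unfolding sum.distrib[symmetric]
    by (intro sum.cong refl)
      (auto simp: derivationD(3)[OF D] divided_power_simps(2)[OF D] Suc_diff_le
        simp flip: scale_mult_left scale_mult_right simp del: of_nat_Suc)
  also have "(\<Sum>i\<le>n. scale (of_nat (Suc i)) (?d (Suc i) p * ?d (n - i) q)) =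
      (\<Sum>i\<le>Suc n. scale (of_nat i) (?d i p * ?d (Suc n - i) q))"
    by (subst sum.atMost_Suc_shift) simp
  also have "(\<Sum>i\<le>n. scale (of_nat (Suc n - i)) (?d i p * ?d (Suc n - i) q)) =
      (\<Sum>i\<le>Suc n. scale (of_nat (Suc n - i)) (?d i p * ?d (Suc n - i) q))"
    by simp
  also have "(\<Sum>i\<le>Suc n. scale (of_nat i) (?d i p * ?d (Suc n - i) q)) + \<dots> =
      (\<Sum>i\<le>Suc n. scale (of_nat (Suc n)) (?d i p * ?d (Suc n - i) q))"
    unfolding sum.distrib[symmetric]
  proof (intro sum.cong refl)
    fix i assume i: "i \<in> {..Suc n}"
    have "scale (of_nat i) r + scale (of_nat (Suc n - i)) r = scale (of_nat (Suc n)) r"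
      for r :: "'a free_alg"
    proof -
      have "of_nat i + of_nat (Suc n - i) = (of_nat (Suc n) :: 'a)"
        using i by (metis atMost_iff le_add_diff_inverse of_nat_add)
      then show ?thesis
        by (intro poly_mapping_eqI) (metis distrib_right lookup_add lookup_scale)
    qed
    then show "scale (of_nat i) (?d i p * ?d (Suc n - i) q) +
        scale (of_nat (Suc n - i)) (?d i p * ?d (Suc n - i) q) =
        scale (of_nat (Suc n)) (?d i p * ?d (Suc n - i) q)" .
  qed
  also have "\<dots> = scale (of_nat (Suc n)) (\<Sum>i\<le>Suc n. ?d i p * ?d (Suc n - i) q)"
    by (simp only: scale_def sum_distrib_left)
  finally have "scale (inverse (of_nat (Suc n))) (scale (of_nat (Suc n)) (?d (Suc n) (p * q))) =
      scale (inverse (of_nat (Suc n))) (scale (of_nat (Suc n)) (\<Sum>i\<le>Suc n. ?d i p * ?d (Suc n - i) q))"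
    by simp
  then show ?case
    by (simp del: of_nat_Suc sum.atMost_Suc)
qed

section \<open>Leading parts of locally nilpotent derivations\<close>

text \<open>
  On an element that is homogeneous of weight \<open>e\<close>, the part of \<open>D\<^sup>n\<close> of the highest possible
  weight \<open>e + n d\<close> is \<open>E\<^sup>n\<close>. Hence \<open>E\<^sup>n\<close> vanishes there as soon as \<open>D\<^sup>n\<close> does.
\<close>

lemma locally_nilpotent_leading_part:
  fixes D E :: "'k::field free_alg \<Rightarrow> 'k free_alg" and W :: "fword \<Rightarrow> int"
  assumes D: "derivation D" "locally_nilpotent D" and E: "derivation E"
    and W: "\<And>u v. W (u + v) = W u + W v"
    and hom: "words_in (\<lambda>w. W w = W (FWord [LX]) + d) (E genX)"
      "words_in (\<lambda>w. W w = W (FWord [LY]) + d) (E genY)"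
    and low: "words_in (\<lambda>w. W w \<le> W (FWord [LX]) + (d - 1)) (D genX - E genX)"
      "words_in (\<lambda>w. W w \<le> W (FWord [LY]) + (d - 1)) (D genY - E genY)"
  shows "locally_nilpotent E"
proof (rule locally_nilpotentI_words[OF E])
  fix u :: fword
  let ?u = "Poly_Mapping.single u (1::'k)"
  have E_top: "words_in (\<lambda>w. W w = W u + int n * d) ((E ^^ n) ?u)" for n
  proof (induction n)
    case (Suc n)
    then show ?case
      using derivation_shifts_support[where R = "(=)", OF E W _ hom Suc]
      by (simp add: algebra_simps)
  qed (simp add: words_in_single)
  have diff: "derivation (\<lambda>p. D p - E p)"
    by (rule derivation_diff[OF D(1) E])
  have DE_low: "words_in (\<lambda>w. W w \<le> W u + int n * d - 1) ((D ^^ n) ?u - (E ^^ n) ?u)" for n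
  proof (induction n)
    case (Suc n)
    let ?p = "(D ^^ n) ?u" and ?q = "(E ^^ n) ?u"
    have "words_in (\<lambda>w. W w \<le> W u + int n * d - 1 + d) (E (?p - ?q))"
      by (rule derivation_shifts_support[where R = "(\<le>)", OF E W _ _ _ Suc])
        (use hom in \<open>auto elim: words_in_mono\<close>)
    moreover have "words_in (\<lambda>w. W w \<le> W u + int n * d) ?p"
    proof -
      have "words_in (\<lambda>w. W w \<le> W u + int n * d) ((?p - ?q) + ?q)"
        by (intro words_in_add words_in_mono[OF Suc] words_in_mono[OF E_top]) auto
      then show ?thesis by simp
    qed
    then have "words_in (\<lambda>w. W w \<le> W u + int n * d + (d - 1)) (D ?p - E ?p)"
      by (intro derivation_shifts_support[where R = "(\<le>)", OF diff W _ low]) auto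
    ultimately have "words_in (\<lambda>w. W w \<le> W u + int (Suc n) * d - 1) (E (?p - ?q) + (D ?p - E ?p))"
      by (intro words_in_add) (simp_all add: algebra_simps)
    then show ?case by (simp add: derivationD(6)[OF E])
  qed simp
  obtain n where "(D ^^ n) ?u = 0"
    using D(2) unfolding locally_nilpotent_def by blast
  then have "words_in (\<lambda>w. W w \<le> W u + int n * d - 1) (0 - (E ^^ n) ?u)"
    using DE_low[of n] by simp
  from words_in_diff[OF words_in_0 this]
  have "words_in (\<lambda>w. W w \<le> W u + int n * d - 1) ((E ^^ n) ?u)" by simp
  from words_in_contradictory[OF this E_top[of n]] show "\<exists>n. (E ^^ n) ?u = 0" by auto
qed

lemma leading_part:
  fixes D :: "'k::field free_alg \<Rightarrow> 'k free_alg" and W :: "fword \<Rightarrow> int"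
  assumes D: "derivation D" "locally_nilpotent D" and nz: "D \<noteq> (\<lambda>_. 0)"
    and W: "\<And>u v. W (u + v) = W u + W v"
  obtains d E where "derivation E" "locally_nilpotent E" "E \<noteq> (\<lambda>_. 0)"
    "E genX = part (\<lambda>w. W w = W (FWord [LX]) + d) (D genX)"
    "E genY = part (\<lambda>w. W w = W (FWord [LY]) + d) (D genY)"
    "words_in (\<lambda>w. W w \<le> W (FWord [LX]) + d) (D genX)"
    "words_in (\<lambda>w. W w \<le> W (FWord [LY]) + d) (D genY)"
proof -
  define S where "S = (\<lambda>w. W w - W (FWord [LX])) ` Poly_Mapping.keys (D genX) \<union>
    (\<lambda>w. W w - W (FWord [LY])) ` Poly_Mapping.keys (D genY)"
  have "finite S" by (simp add: S_def)
  have "D genX \<noteq> 0 \<or> D genY \<noteq> 0"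
    using nz derivation_eqI[OF D(1) derivation_zero] by auto
  then have "S \<noteq> {}" by (auto simp: S_def)
  define d where "d = Max S"
  have d: "s \<le> d" if "s \<in> S" for s
    using \<open>finite S\<close> that by (simp add: d_def)
  have "d \<in> S"
    using \<open>finite S\<close> \<open>S \<noteq> {}\<close> by (simp add: d_def)
  have X: "words_in (\<lambda>w. W w \<le> W (FWord [LX]) + d) (D genX)"
    and Y: "words_in (\<lambda>w. W w \<le> W (FWord [LY]) + d) (D genY)"
    using d by (force simp: words_in_def S_def)+
  obtain E where E: "derivation E" "E genX = part (\<lambda>w. W w = W (FWord [LX]) + d) (D genX)"
    "E genY = part (\<lambda>w. W w = W (FWord [LY]) + d) (D genY)"
    by (rule derivation_with_values)
  have below: "words_in (\<lambda>w. W w \<le> e + (d - 1)) (p - part (\<lambda>w. W w = e + d) p)"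
    if "words_in (\<lambda>w. W w \<le> e + d) p" for e and p :: "'k free_alg"
    unfolding words_in_def
  proof
    fix w assume "w \<in> Poly_Mapping.keys (p - part (\<lambda>w. W w = e + d) p)"
    then have "W w \<noteq> e + d" "w \<in> Poly_Mapping.keys p"
      by (auto simp: in_keys_iff lookup_minus lookup_part split: if_splits)
    with that show "W w \<le> e + (d - 1)" by (fastforce simp: words_in_def)
  qed
  have top: "words_in (\<lambda>w. W w = e) (part (\<lambda>w. W w = e) p)" for e and p :: "'k free_alg"
    by (auto simp: words_in_def in_keys_iff lookup_part split: if_splits)
  have "locally_nilpotent E"
    by (rule locally_nilpotent_leading_part[where W = W and d = d, OF D E(1) W])
      (simp_all add: E top below X Y)
  moreover have "E \<noteq> (\<lambda>_. 0)"
  proof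
    assume "E = (\<lambda>_. 0)"
    then have "Poly_Mapping.lookup (E genX) w = 0" "Poly_Mapping.lookup (E genY) w = 0" for w
      by simp_all
    then have "W w \<noteq> W (FWord [LX]) + d \<or> Poly_Mapping.lookup (D genX) w = 0"
      "W w \<noteq> W (FWord [LY]) + d \<or> Poly_Mapping.lookup (D genY) w = 0" for w
      unfolding E lookup_part by metis+
    then have "d \<notin> S"
      unfolding S_def in_keys_iff by force
    with \<open>d \<in> S\<close> show False by simp
  qed
  ultimately show thesis using that E X Y by blast
qed

section \<open>Substituting words for letters\<close>

definition replace_letters :: "letter list \<Rightarrow> letter list \<Rightarrow> letter list \<Rightarrow> letter list" where
  "replace_letters U V ls = concat (map (case_letter U V) ls)"

lemma replace_letters_simps [simp]:
  "replace_letters U V [] = []"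
  "replace_letters U V (LX # ls) = U @ replace_letters U V ls"
  "replace_letters U V (LY # ls) = V @ replace_letters U V ls"
  "replace_letters U V (ks @ ls) = replace_letters U V ks @ replace_letters U V ls"
  by (simp_all add: replace_letters_def)

text \<open>
  Two words whose bidegrees are not proportional generate a free monoid. If neither is a prefix of the
  other, the first letter can be read off from the concatenation. If \<open>V = U @ V'\<close>, then substituting
  \<open>(U, V)\<close> is substituting \<open>(U, V')\<close> after the injective shear \<open>x \<mapsto> x, y \<mapsto> x y\<close>; this keeps
  the determinant of the bidegrees and shortens the words, as in Euclid's algorithm.
\<close>

lemma inj_replace_letters:
  assumes "count_list U LX * count_list V LY \<noteq> count_list V LX * count_list U LY"
  shows "inj (replace_letters U V)"
  using assms
proof (induction "length U + length V" arbitrary: U V rule: less_induct)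
  case less
  have *: "inj (replace_letters U V)"
    if len: "length U \<le> length V" and det: "count_list U LX * count_list V LY \<noteq> count_list V LX * count_list U LY"
      and IH: "\<And>V'. length V' < length V \<Longrightarrow>
         count_list U LX * count_list V' LY \<noteq> count_list V' LX * count_list U LY \<Longrightarrow>
         inj (replace_letters U V')" for U V
  proof (cases "\<exists>V'. V = U @ V'")
    case True
    then obtain V' where V: "V = U @ V'" by blast
    have inj: "inj (replace_letters U V')"
      using det V by (intro IH) (auto simp: algebra_simps)
    \<comment> \<open>substituting (U, U V') is substituting (U, V') after y is replaced by x y\<close>
    have shear: "replace_letters U V ls =
        replace_letters U V' (replace_letters [LX] [LX, LY] ls)" for ls
    proof (induction ls)
      case (Cons l ls)
      then show ?case by (cases l) (auto simp: V)
    qed simp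
    have "inj (replace_letters [LX] [LX, LY])"
    proof
      fix r s
      have not_LY: "replace_letters [LX] [LX, LY] q \<noteq> LY # t" for q t
      proof (cases q)
        case (Cons l q')
        then show ?thesis by (cases l) auto
      qed simp
      show "replace_letters [LX] [LX, LY] r = replace_letters [LX] [LX, LY] s \<Longrightarrow> r = s"
      proof (induction r arbitrary: s)
        case Nil
        show ?case
        proof (cases s)
          case (Cons l s')
          then show ?thesis using Nil by (cases l) auto
        qed simp
      next
        case (Cons l r)
        show ?case
        proof (cases s)
          case Nil
          then show ?thesis using Cons.prems by (cases l) auto
        next
          case (Cons l' s')
          then show ?thesis
            using Cons.prems Cons.IH not_LY not_LY[symmetric] by (cases l; cases l') auto
        qed
      qed
    qed
    with inj have "inj (replace_letters U V' \<circ> replace_letters [LX] [LX, LY])"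
      by (rule inj_compose)
    moreover have "replace_letters U V = replace_letters U V' \<circ> replace_letters [LX] [LX, LY]"
      by (rule ext) (metis shear comp_apply)
    ultimately show ?thesis by simp
  next
    case False
    have nonempty: "U \<noteq> []" "V \<noteq> []" using det by auto
    have differ: "U @ r \<noteq> V @ s" for r s
      using False len by (metis append_eq_append_conv_if append_take_drop_id)
    show ?thesis
    proof
      fix r s
      show "replace_letters U V r = replace_letters U V s \<Longrightarrow> r = s"
      proof (induction r arbitrary: s)
        case Nil
        show ?case
        proof (cases s)
          case (Cons l s')
          then show ?thesis using Nil nonempty by (cases l) auto
        qed simp
      next
        case (Cons l r)
        show ?case
        proof (cases s)
          case Nil
          then show ?thesis using Cons.prems nonempty by (cases l) auto
        next
          case (Cons l' s')
          then show ?thesis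
            using Cons.prems Cons.IH differ differ[symmetric] by (cases l; cases l') auto
        qed
      qed
    qed
  qed
  have swap: "replace_letters U V ls = replace_letters V U (map (case_letter LY LX) ls)" for U V ls
  proof (induction ls)
    case (Cons l ls)
    then show ?case by (cases l) auto
  qed simp
  have inj_swap: "inj (map (case_letter LY LX))"
    by (intro inj_mapI) (auto simp: inj_def split: letter.splits)
  show ?case
  proof (cases "length U \<le> length V")
    case True
    then show ?thesis
      by (rule *[OF _ less.prems]) (rule less.hyps, simp_all)
  next
    case False
    have "inj (replace_letters V U)"
    proof (rule *)
      show "count_list V LX * count_list U LY \<noteq> count_list U LX * count_list V LY"
        using less.prems by simp
    qed (use False in simp, rule less.hyps, simp_all)
    with inj_swap have "inj (replace_letters V U \<circ> map (case_letter LY LX))"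
      by (intro inj_compose)
    moreover have "replace_letters U V = replace_letters V U \<circ> map (case_letter LY LX)"
      by (rule ext) (metis swap comp_apply)
    ultimately show ?thesis by simp
  qed
qed

section \<open>Leading words\<close>

text \<open>
  Reading a word as a binary number turns the lexicographic comparison of words of equal length into
  the comparison of natural numbers.
\<close>

primrec binary_value :: "letter list \<Rightarrow> nat" where
  "binary_value [] = 0"
| "binary_value (l # ls) = (if l = LY then 2 ^ length ls else 0) + binary_value ls"

lemma binary_value_append: "binary_value (us @ vs) = binary_value us * 2 ^ length vs + binary_value vs"
  by (induction us) (auto simp: power_add algebra_simps)

lemma binary_value_less: "binary_value ls < 2 ^ length ls"
  by (induction ls) auto

lemma binary_value_inj: "length us = length vs \<Longrightarrow> binary_value us = binary_value vs \<Longrightarrow> us = vs"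
proof (induction us vs rule: list_induct2)
  case (Cons u us v vs)
  show ?case
    using Cons binary_value_less[of us] binary_value_less[of vs]
    by (cases u; cases v) auto
qed simp

definition lower :: "fword \<Rightarrow> fword \<Rightarrow> bool" where
  "lower u v \<longleftrightarrow> length (letters u) = length (letters v) \<and>
     binary_value (letters u) < binary_value (letters v)"

lemma lower_irrefl: "\<not> lower w w"
  by (simp add: lower_def)

lemma lower_trans: "lower u v \<Longrightarrow> lower v w \<Longrightarrow> lower u w"
  by (auto simp: lower_def)

lemma lower_add_left: "lower u u' \<Longrightarrow> v = v' \<or> lower v v' \<Longrightarrow> lower (u + v) (u' + v')"
  by (auto simp: lower_def plus_fword_def binary_value_append intro: add_less_le_mono add_less_mono)

lemma lower_add_right: "lower v v' \<Longrightarrow> lower (u + v) (u + v')"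
  by (auto simp: lower_def plus_fword_def binary_value_append)

definition leading_term :: "'k::field free_alg \<Rightarrow> fword \<Rightarrow> 'k \<Rightarrow> bool" where
  "leading_term p w c \<longleftrightarrow> c \<noteq> 0 \<and> words_in (\<lambda>v. lower v w) (p - Poly_Mapping.single w c)"

lemma leading_term_words: "leading_term p w c \<Longrightarrow> words_in (\<lambda>v. v = w \<or> lower v w) p"
proof -
  assume "leading_term p w c"
  then have "words_in (\<lambda>v. v = w \<or> lower v w) ((p - Poly_Mapping.single w c) + Poly_Mapping.single w c)"
    by (intro words_in_add) (auto simp: leading_term_def words_in_single elim: words_in_mono)
  then show ?thesis by simp
qed

lemma leading_term_nonzero: "leading_term p w c \<Longrightarrow> p \<noteq> 0"
proof
  assume *: "leading_term p w c" "p = 0"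
  then have "words_in (\<lambda>v. lower v w) (0 - Poly_Mapping.single w c)"
    by (auto simp: leading_term_def)
  from words_in_diff[OF words_in_0 this]
  have "words_in (\<lambda>v. lower v w) (Poly_Mapping.single w c)" by simp
  with * show False by (simp add: leading_term_def words_in_single lower_irrefl)
qed

text \<open>
  The order on words of equal length is compatible with concatenation on both sides, so leading terms
  multiply.
\<close>

lemma leading_term_mult:
  assumes "leading_term p u c" "leading_term q v e"
  shows "leading_term (p * q) (u + v) (c * e)"
proof -
  let ?s = "Poly_Mapping.single u c" and ?t = "Poly_Mapping.single v e"
  have "words_in (\<lambda>w. lower w (u + v)) ((p - ?s) * q + ?s * (q - ?t))"
  proof (intro words_in_add)
    show "words_in (\<lambda>w. lower w (u + v)) ((p - ?s) * q)"
      using assms(1) leading_term_words[OF assms(2)]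
      by (auto simp: leading_term_def intro: words_in_mult lower_add_left)
    show "words_in (\<lambda>w. lower w (u + v)) (?s * (q - ?t))"
      by (rule words_in_mult[where Q = "\<lambda>w. w = u" and R = "\<lambda>w. lower w v"])
        (use assms(2) in \<open>auto simp: leading_term_def words_in_single intro: lower_add_right\<close>)
  qed
  also have "(p - ?s) * q + ?s * (q - ?t) = p * q - Poly_Mapping.single (u + v) (c * e)"
    by (simp add: algebra_simps mult_single)
  finally show ?thesis using assms by (simp add: leading_term_def)
qed

lemma finite_maximizer:
  fixes f :: "'a \<Rightarrow> nat"
  assumes "finite A" "A \<noteq> {}"
  obtains w where "w \<in> A" "\<And>v. v \<in> A \<Longrightarrow> f v \<le> f w"
proof -
  have "Max (f ` A) \<in> f ` A" using assms by simp
  then obtain w where "w \<in> A" "Max (f ` A) = f w" by blast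
  with assms show thesis by (metis Max_ge finite_imageI imageI that)
qed

lemma leading_term_exists:
  assumes "p \<noteq> 0" "words_in (\<lambda>w. length (letters w) = L) p"
  obtains w c where "leading_term p w c" "w \<in> Poly_Mapping.keys p"
proof -
  let ?f = "\<lambda>w. binary_value (letters w)"
  obtain w where
    w: "w \<in> Poly_Mapping.keys p" "\<And>v. v \<in> Poly_Mapping.keys p \<Longrightarrow> ?f v \<le> ?f w"
    by (rule finite_maximizer[of "Poly_Mapping.keys p" ?f]) (use assms(1) in auto)
  let ?c = "Poly_Mapping.lookup p w"
  have "lower v w" if "v \<in> Poly_Mapping.keys (p - Poly_Mapping.single w ?c)" for v
  proof -
    have "v \<noteq> w" "v \<in> Poly_Mapping.keys p"
      using that by (auto simp: in_keys_iff lookup_minus lookup_single when_def split: if_splits)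
    then have len: "length (letters v) = length (letters w)" and "letters v \<noteq> letters w"
      using w(1) assms(2) by (auto simp: words_in_def fword.expand)
    then have "?f v \<noteq> ?f w" using binary_value_inj by blast
    with w(2) len \<open>v \<in> Poly_Mapping.keys p\<close> show ?thesis
      by (simp add: lower_def order.strict_iff_order)
  qed
  with w(1) have "leading_term p w ?c"
    by (auto simp: leading_term_def words_in_def in_keys_iff)
  with w(1) show thesis by (rule that[rotated])
qed

lemma leading_term_word_eval:
  assumes "leading_term p U c" "leading_term q V e"
  shows "leading_term (word_eval p q w)
    (FWord (replace_letters (letters U) (letters V) (letters w))) (c ^ degX w * e ^ degY w)"
proof (induction w rule: fword_induct)
  case empty
  have "(1 :: 'a free_alg) = Poly_Mapping.single 0 1" by simp
  then show ?case by (simp add: leading_term_def zero_fword_def del: single_one)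
next
  case (LX w)
  have "FWord (replace_letters (letters U) (letters V) (letters (FWord [LX] + w))) =
      U + FWord (replace_letters (letters U) (letters V) (letters w))"
    by (simp add: plus_fword_def)
  with leading_term_mult[OF assms(1) LX] show ?case
    by (simp add: word_eval_add mult.assoc)
next
  case (LY w)
  have "FWord (replace_letters (letters U) (letters V) (letters (FWord [LY] + w))) =
      V + FWord (replace_letters (letters U) (letters V) (letters w))"
    by (simp add: plus_fword_def)
  with leading_term_mult[OF assms(2) LY] show ?case
    by (simp add: word_eval_add mult_ac)
qed

lemma length_replace_letters:
  "length (replace_letters U V ls) = count_list ls LX * length U + count_list ls LY * length V"
proof (induction ls)
  case (Cons l ls)
  then show ?case by (cases l) auto
qed simp

lemma subst_gens_sum:
  "subst_gens p q f = (\<Sum>w\<in>Poly_Mapping.keys f. scale (Poly_Mapping.lookup f w) (word_eval p q w))"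
  by (simp add: subst_def extend_def scale_def)

text \<open>
  The words of \<open>f\<close> produce pairwise distinct leading words, all of the same length because \<open>f\<close> is
  bihomogeneous; the largest of them cannot cancel.
\<close>

lemma subst_gens_nonzero:
  assumes p: "leading_term p U c" and q: "leading_term q V e"
    and inj: "inj (replace_letters (letters U) (letters V))"
    and f: "f \<noteq> 0" "words_in (\<lambda>w. degX w = r \<and> degY w = s) f"
  shows "subst_gens p q f \<noteq> 0"
proof -
  let ?K = "\<lambda>w. FWord (replace_letters (letters U) (letters V) (letters w))"
  let ?f = "\<lambda>w. binary_value (letters (?K w))"
  obtain w where
    w: "w \<in> Poly_Mapping.keys f" "\<And>v. v \<in> Poly_Mapping.keys f \<Longrightarrow> ?f v \<le> ?f w"
    by (rule finite_maximizer[of "Poly_Mapping.keys f" ?f]) (use f(1) in auto)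
  have below: "lower (?K v) (?K w)" if "v \<in> Poly_Mapping.keys f" "v \<noteq> w" for v
  proof -
    have len: "length (letters (?K v)) = length (letters (?K w))"
      using f(2) that(1) w(1) by (auto simp: words_in_def length_replace_letters degX_def degY_def)
    have "letters (?K v) \<noteq> letters (?K w)"
      using that(2) fword.expand by (auto simp: inj_eq[OF inj])
    with len binary_value_inj have "?f v \<noteq> ?f w" by blast
    with w(2)[OF that(1)] len show ?thesis by (simp add: lower_def)
  qed
  let ?a = "Poly_Mapping.lookup f w"
  have lead: "leading_term (word_eval p q v) (?K v) (c ^ degX v * e ^ degY v)" for v
    by (rule leading_term_word_eval[OF p q])
  have "subst_gens p q f = scale ?a (word_eval p q w) +
      (\<Sum>v\<in>Poly_Mapping.keys f - {w}. scale (Poly_Mapping.lookup f v) (word_eval p q v))"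
    unfolding subst_gens_sum using w(1) by (simp add: sum.remove)
  moreover have "scale ?a (Poly_Mapping.single (?K w) (c ^ degX w * e ^ degY w)) =
      Poly_Mapping.single (?K w) (?a * (c ^ degX w * e ^ degY w))"
    by (simp add: scale_def mult_single)
  ultimately have "subst_gens p q f - Poly_Mapping.single (?K w) (?a * (c ^ degX w * e ^ degY w)) =
      scale ?a (word_eval p q w - Poly_Mapping.single (?K w) (c ^ degX w * e ^ degY w)) +
      (\<Sum>v\<in>Poly_Mapping.keys f - {w}. scale (Poly_Mapping.lookup f v) (word_eval p q v))"
    by (simp add: scale_diff)
  moreover have "words_in (\<lambda>u. lower u (?K w)) (scale ?a
      (word_eval p q w - Poly_Mapping.single (?K w) (c ^ degX w * e ^ degY w)))"
    using lead[of w] by (intro words_in_scale) (simp add: leading_term_def)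
  moreover have "words_in (\<lambda>u. lower u (?K w))
      (\<Sum>v\<in>Poly_Mapping.keys f - {w}. scale (Poly_Mapping.lookup f v) (word_eval p q v))"
  proof (intro words_in_sum words_in_scale)
    fix v assume "v \<in> Poly_Mapping.keys f - {w}"
    then show "words_in (\<lambda>u. lower u (?K w)) (word_eval p q v)"
      using below[of v] lower_trans[of _ "?K v" "?K w"]
      by (intro words_in_mono[OF leading_term_words[OF lead]]) auto
  qed
  ultimately have "words_in (\<lambda>u. lower u (?K w))
      (subst_gens p q f - Poly_Mapping.single (?K w) (?a * (c ^ degX w * e ^ degY w)))"
    by (simp add: words_in_add)
  then have "leading_term (subst_gens p q f) (?K w) (?a * (c ^ degX w * e ^ degY w))"
    using lead[of w] w(1) by (auto simp: leading_term_def in_keys_iff)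
  then show ?thesis by (rule leading_term_nonzero)
qed

section \<open>Bihomogeneous locally nilpotent derivations\<close>

text \<open>
  An order beyond which all divided powers vanish, with the value at that order. Orders add and values
  multiply under products, since only one term of the Leibniz sum survives.
\<close>

definition last_divided_power ::
  "('k::field_char_0 free_alg \<Rightarrow> 'k free_alg) \<Rightarrow> nat \<Rightarrow> 'k free_alg \<Rightarrow> 'k free_alg \<Rightarrow> bool" where
  "last_divided_power D n p u \<longleftrightarrow> divided_power D n p = u \<and> (\<forall>m>n. divided_power D m p = 0)"

lemma last_divided_power_exists:
  fixes D :: "'k::field_char_0 free_alg \<Rightarrow> 'k free_alg"
  assumes D: "derivation D" "locally_nilpotent D" and "p \<noteq> 0"
  obtains n u where "last_divided_power D n p u" "u \<noteq> 0"
proof -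
  define n where "n = (LEAST n. (D ^^ Suc n) p = 0)"
  obtain N where "N \<ge> 1" "(D ^^ N) p = 0"
    using D(2) unfolding locally_nilpotent_def by blast
  then have "(D ^^ Suc (N - 1)) p = 0" by simp
  then have n: "(D ^^ Suc n) p = 0"
    unfolding n_def by (rule LeastI)
  have "(D ^^ n) p \<noteq> 0"
  proof (cases n)
    case (Suc m)
    then show ?thesis using not_less_Least[of m "\<lambda>n. (D ^^ Suc n) p = 0"] n_def by auto
  qed (use assms in simp)
  moreover have "(D ^^ m) p = 0" if "m > n" for m
    using funpow_eq_0_mono[OF D(1) n] that by simp
  ultimately show thesis
    by (intro that[of n "divided_power D n p"])
      (simp_all add: last_divided_power_def divided_power_eq_0_iff)
qed

lemma last_divided_power_mult:
  assumes D: "derivation D" and p: "last_divided_power D m p u" and q: "last_divided_power D n q v"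
  shows "last_divided_power D (m + n) (p * q) (u * v)"
proof -
  have zero: "divided_power D i p * divided_power D (N - i) q = 0"
    if "i \<le> N" "N \<ge> m + n" "i \<noteq> m \<or> N > m + n" for i N
  proof -
    have "i > m \<or> N - i > n" using that by linarith
    then show ?thesis using p q by (auto simp: last_divided_power_def)
  qed
  have "divided_power D (m + n) (p * q) = (\<Sum>i\<in>{m}. divided_power D i p * divided_power D (m + n - i) q)"
    unfolding divided_power_mult[OF D]
    by (rule sum.mono_neutral_right) (use zero in auto)
  moreover have "divided_power D N (p * q) = 0" if "N > m + n" for N
    unfolding divided_power_mult[OF D] by (rule sum.neutral) (use zero that in auto)
  ultimately show ?thesis
    using p q by (simp add: last_divided_power_def)
qed

lemma last_divided_power_word:
  assumes D: "derivation D" and X: "last_divided_power D m genX u" and Y: "last_divided_power D n genY v"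
  shows "last_divided_power D (m * degX w + n * degY w) (Poly_Mapping.single w 1) (word_eval u v w)"
proof (induction w rule: fword_induct)
  case empty
  have "(D ^^ k) 1 = 0" if "k > 0" for k
    using funpow_eq_0_mono[OF D, of 1 1 k] derivationD(5)[OF D] that by simp
  then show ?case
    by (simp add: last_divided_power_def divided_power_eq_0_iff divided_power_simps[OF D])
next
  case (LX w)
  from last_divided_power_mult[OF D X LX] show ?case
    by (simp add: single_letter_add word_eval_add algebra_simps)
next
  case (LY w)
  from last_divided_power_mult[OF D Y LY] show ?case
    by (simp add: single_letter_add word_eval_add algebra_simps)
qed

lemma divided_power_bihomogeneous:
  assumes D: "derivation D" and X: "last_divided_power D m genX u" and Y: "last_divided_power D n genY v"
    and f: "words_in (\<lambda>w. degX w = r \<and> degY w = s) f"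
  shows "divided_power D (m * r + n * s) f = subst_gens u v f"
proof -
  have "divided_power D (m * r + n * s) (Poly_Mapping.single w 1) = word_eval u v w"
    if "w \<in> Poly_Mapping.keys f" for w
    using last_divided_power_word[OF D X Y, of w] f that
    by (auto simp: last_divided_power_def words_in_def)
  then show ?thesis
    unfolding subst_gens_sum
    by (subst sum_words[of f, symmetric]) (simp add: divided_power_linear[OF D])
qed

text \<open>
  Let \<open>u\<close> and \<open>v\<close> be the last divided powers of the generators, of orders \<open>m\<close> and \<open>n\<close>. Their bidegrees
  \<open>(1 + m i, m j)\<close> and \<open>(n i, 1 + n j)\<close> have determinant \<open>1 + m i + n j > 0\<close>, so \<open>f (u, v) \<noteq> 0\<close> for every
  bihomogeneous \<open>f \<noteq> 0\<close>. If \<open>D x \<noteq> 0\<close>, taking \<open>f = D x\<close> shows that the divided power of order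
  \<open>m (i + 1) + n j \<ge> m\<close> does not kill \<open>D x\<close>, which contradicts the choice of \<open>m\<close>; likewise for \<open>y\<close>.
\<close>

lemma bihomogeneous_derivation_eq_0:
  fixes D :: "'k::field_char_0 free_alg \<Rightarrow> 'k free_alg"
  assumes D: "derivation D" "locally_nilpotent D"
    and X: "words_in (\<lambda>w. degX w = Suc i \<and> degY w = j) (D genX)"
    and Y: "words_in (\<lambda>w. degX w = i \<and> degY w = Suc j) (D genY)"
  shows "D = (\<lambda>_. 0)"
proof -
  have "genX \<noteq> (0 :: 'k free_alg)" "genY \<noteq> (0 :: 'k free_alg)"
    by (auto simp: genX_def genY_def poly_mapping_eq_iff fun_eq_iff lookup_single)
  then obtain m u n v where u: "last_divided_power D m genX u" "u \<noteq> 0"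
    and v: "last_divided_power D n genY v" "v \<noteq> 0"
    using last_divided_power_exists[OF D] by metis
  have bideg: "words_in (\<lambda>w. degX w = degX z + k * i \<and> degY w = degY z + k * j)
      ((D ^^ k) (Poly_Mapping.single z 1))" for z k
  proof -
    have "words_in (\<lambda>w. int (degX w) = int (degX z) + int k * int i) ((D ^^ k) (Poly_Mapping.single z 1))"
    proof (induction k)
      case (Suc k)
      have "words_in (\<lambda>w. int (degX w) = int (degX z) + int k * int i + int i)
          (D ((D ^^ k) (Poly_Mapping.single z 1)))"
        by (rule derivation_shifts_support[where R = "(=)" and W = "\<lambda>w. int (degX w)", OF D(1) _ _ _ _ Suc])
          (auto intro: words_in_mono[OF X] words_in_mono[OF Y])
      then show ?case by (simp add: algebra_simps)
    qed (simp add: words_in_single)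
    moreover have "words_in (\<lambda>w. int (degY w) = int (degY z) + int k * int j) ((D ^^ k) (Poly_Mapping.single z 1))"
    proof (induction k)
      case (Suc k)
      have "words_in (\<lambda>w. int (degY w) = int (degY z) + int k * int j + int j)
          (D ((D ^^ k) (Poly_Mapping.single z 1)))"
        by (rule derivation_shifts_support[where R = "(=)" and W = "\<lambda>w. int (degY w)", OF D(1) _ _ _ _ Suc])
          (auto intro: words_in_mono[OF X] words_in_mono[OF Y])
      then show ?case by (simp add: algebra_simps)
    qed (simp add: words_in_single)
    ultimately show ?thesis
      unfolding words_in_def by (metis of_nat_add of_nat_eq_iff of_nat_mult)
  qed
  have u_deg: "words_in (\<lambda>w. degX w = 1 + m * i \<and> degY w = m * j) u"
    using words_in_scale[OF bideg[of "FWord [LX]" m]] u(1)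
    by (simp add: last_divided_power_def divided_power_def genX_def) blast
  have v_deg: "words_in (\<lambda>w. degX w = n * i \<and> degY w = 1 + n * j) v"
    using words_in_scale[OF bideg[of "FWord [LY]" n]] v(1)
    by (simp add: last_divided_power_def divided_power_def genY_def) blast
  obtain U c where U: "leading_term u U c" "U \<in> Poly_Mapping.keys u"
    by (rule leading_term_exists[OF u(2), of "1 + m * i + m * j"])
      (auto intro: words_in_mono[OF u_deg] simp: length_letters)
  obtain V e where V: "leading_term v V e" "V \<in> Poly_Mapping.keys v"
    by (rule leading_term_exists[OF v(2), of "n * i + (1 + n * j)"])
      (auto intro: words_in_mono[OF v_deg] simp: length_letters)
  have "degX U = 1 + m * i" "degY U = m * j" "degX V = n * i" "degY V = 1 + n * j"
    using u_deg v_deg U(2) V(2) by (auto simp: words_in_def)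
  then have "degX U * degY V \<noteq> degX V * degY U"
    by (simp add: algebra_simps)
  then have inj: "inj (replace_letters (letters U) (letters V))"
    by (intro inj_replace_letters) (simp add: degX_def degY_def)
  have "f = 0" if f: "words_in (\<lambda>w. degX w = r \<and> degY w = s) f"
    and "divided_power D (m * r + n * s) f = 0" for f r s
    using subst_gens_nonzero[OF U(1) V(1) inj _ f] divided_power_bihomogeneous[OF D(1) u(1) v(1) f] that(2)
    by auto
  note * = this[OF X] this[OF Y]
  have "D genX = 0"
    using u(1) by (intro *(1)) (simp add: divided_power_simps[OF D(1)] last_divided_power_def del: of_nat_Suc)
  moreover have "D genY = 0"
    using v(1) by (intro *(2)) (simp add: divided_power_simps[OF D(1)] last_divided_power_def del: of_nat_Suc)
  ultimately show ?thesis
    using derivation_eqI[OF D(1) derivation_zero] by simp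
qed

section \<open>Support on the coordinate axes\<close>

abbreviation xpow :: "nat \<Rightarrow> fword" where "xpow n \<equiv> FWord (replicate n LX)"
abbreviation ypow :: "nat \<Rightarrow> fword" where "ypow n \<equiv> FWord (replicate n LY)"

lemma eq_replicate_if_count: "count_list ls l = length ls \<Longrightarrow> ls = replicate (length ls) l"
proof (induction ls)
  case (Cons a ls)
  then show ?case using count_le_length[of ls l] by (auto split: if_splits)
qed simp

lemma eq_xpow_iff: "w = xpow n \<longleftrightarrow> degX w = n \<and> degY w = 0"
  and eq_ypow_iff: "w = ypow n \<longleftrightarrow> degX w = 0 \<and> degY w = n"
proof -
  have rep: "count_list (replicate n a) b = (if a = b then n else 0)" for a b :: letter
    by (induction n) auto
  have "letters w = replicate n LX" if "degX w = n" "degY w = 0"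
    using that length_letters[of w] eq_replicate_if_count[of "letters w" LX] by (simp add: degX_def)
  then show "w = xpow n \<longleftrightarrow> degX w = n \<and> degY w = 0"
    by (cases w) (auto simp: degX_def degY_def rep)
  have "letters w = replicate n LY" if "degX w = 0" "degY w = n"
    using that length_letters[of w] eq_replicate_if_count[of "letters w" LY] by (simp add: degY_def)
  then show "w = ypow n \<longleftrightarrow> degX w = 0 \<and> degY w = n"
    by (cases w) (auto simp: degX_def degY_def rep)
qed

text \<open>
  Passing to the part of highest degree in \<open>x\<close> makes the derivation bihomogeneous, as \<open>b > 0\<close>. If no
  word of \<open>E x\<close> were free of \<open>x\<close> and none of \<open>E y\<close> free of \<open>y\<close>, then its bidegree shift would be
  nonnegative in both coordinates.
\<close>

lemma weighted_homogeneous_border: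
  fixes E :: "'k::field_char_0 free_alg \<Rightarrow> 'k free_alg" and a b :: nat and d :: int
  assumes E: "derivation E" "locally_nilpotent E" "E \<noteq> (\<lambda>_. 0)" and b: "b > 0"
    and X: "words_in (\<lambda>w. int (a * degX w + b * degY w) = int a + d) (E genX)"
    and Y: "words_in (\<lambda>w. int (a * degX w + b * degY w) = int b + d) (E genY)"
  shows "(\<exists>w\<in>Poly_Mapping.keys (E genX). degX w = 0) \<or> (\<exists>w\<in>Poly_Mapping.keys (E genY). degY w = 0)"
proof (rule ccontr)
  assume "\<not> ?thesis"
  then have inner: "words_in (\<lambda>w. degX w > 0) (E genX)" "words_in (\<lambda>w. degY w > 0) (E genY)"
    by (auto simp: words_in_def)
  obtain e F where F: "derivation F" "locally_nilpotent F" "F \<noteq> (\<lambda>_. 0)"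
    "F genX = part (\<lambda>w. int (degX w) = int (degX (FWord [LX])) + e) (E genX)"
    "F genY = part (\<lambda>w. int (degX w) = int (degX (FWord [LY])) + e) (E genY)"
    by (rule leading_part[OF E, of "\<lambda>w. int (degX w)"]) auto
  have keysX: "int (degX w) = 1 + e \<and> degX w > 0 \<and> int (a * degX w + b * degY w) = int a + d"
    if "w \<in> Poly_Mapping.keys (F genX)" for w
  proof -
    have "int (degX w) = 1 + e" "w \<in> Poly_Mapping.keys (E genX)"
      using that by (auto simp: F in_keys_iff lookup_part split: if_splits)
    with X inner(1) show ?thesis unfolding words_in_def by blast
  qed
  have keysY: "int (degX w) = e \<and> degY w > 0 \<and> int (a * degX w + b * degY w) = int b + d"
    if "w \<in> Poly_Mapping.keys (F genY)" for w
  proof -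
    have "int (degX w) = e" "w \<in> Poly_Mapping.keys (E genY)"
      using that by (auto simp: F in_keys_iff lookup_part split: if_splits)
    with Y inner(2) show ?thesis unfolding words_in_def by blast
  qed
  have "F genX \<noteq> 0 \<or> F genY \<noteq> 0"
    using F(3) derivation_eqI[OF F(1) derivation_zero] by auto
  \<comment> \<open>a word of the image of x has at least one x, one of the image of y at least one y,
    so both coordinates of the shift are natural numbers\<close>
  then have "\<exists>i j :: nat. e = int i \<and> d = int (a * i + b * j)"
  proof
    assume "F genX \<noteq> 0"
    then obtain w where w: "w \<in> Poly_Mapping.keys (F genX)" by fastforce
    then obtain i where "degX w = Suc i"
      using keysX gr0_implies_Suc by blast
    with keysX[OF w] have "e = int i \<and> d = int (a * i + b * degY w)"
      by (auto simp: algebra_simps)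
    then show ?thesis by blast
  next
    assume "F genY \<noteq> 0"
    then obtain w where w: "w \<in> Poly_Mapping.keys (F genY)" by fastforce
    then obtain j where "degY w = Suc j"
      using keysY gr0_implies_Suc by blast
    with keysY[OF w] have "e = int (degX w) \<and> d = int (a * degX w + b * j)"
      by (auto simp: algebra_simps)
    then show ?thesis by blast
  qed
  then obtain i j :: nat where ij: "e = int i" "d = int (a * i + b * j)" by blast
  have "F = (\<lambda>_. 0)"
  proof (rule bihomogeneous_derivation_eq_0[OF F(1,2)])
    show "words_in (\<lambda>w. degX w = Suc i \<and> degY w = j) (F genX)"
      unfolding words_in_def
    proof (intro ballI conjI)
      fix w assume "w \<in> Poly_Mapping.keys (F genX)"
      note w = keysX[OF this]
      from w show *: "degX w = Suc i" unfolding ij by simp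
      have "int (b * degY w) = int (b * j)"
        using w unfolding ij * by (simp add: algebra_simps)
      with b show "degY w = j" by (simp only: of_nat_eq_iff) simp
    qed
    show "words_in (\<lambda>w. degX w = i \<and> degY w = Suc j) (F genY)"
      unfolding words_in_def
    proof (intro ballI conjI)
      fix w assume "w \<in> Poly_Mapping.keys (F genY)"
      note w = keysY[OF this]
      from w show *: "degX w = i" unfolding ij by simp
      have "int (b * degY w) = int (b * Suc j)"
        using w unfolding ij * by (simp add: algebra_simps)
      with b show "degY w = Suc j" by (simp only: of_nat_eq_iff mult_cancel1) simp
    qed
  qed
  with F(3) show False by simp
qed

definition triangular :: "('k::field free_alg \<Rightarrow> 'k free_alg) \<Rightarrow> bool" where
  "triangular D \<longleftrightarrow> D genX = 0 \<and> words_in (\<lambda>w. degY w = 0) (D genY)"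

text \<open>
  The part of highest degree in \<open>y\<close> must reach a coordinate axis. Since \<open>D x\<close> has no pure words in
  \<open>y\<close>, it does so in a word of \<open>D y\<close> of degree \<open>0\<close> in \<open>y\<close>; so the highest shift of the degree in
  \<open>y\<close> is \<open>-1\<close>.
\<close>

lemma triangular_if_no_pure_y_words:
  fixes D :: "'k::field_char_0 free_alg \<Rightarrow> 'k free_alg"
  assumes D: "derivation D" "locally_nilpotent D" "D \<noteq> (\<lambda>_. 0)"
    and pure: "words_in (\<lambda>w. degX w > 0) (D genX)"
  shows "triangular D"
proof -
  obtain d E where E: "derivation E" "locally_nilpotent E" "E \<noteq> (\<lambda>_. 0)"
    and EX: "E genX = part (\<lambda>w. int (degY w) = int (degY (FWord [LX])) + d) (D genX)"
    and EY: "E genY = part (\<lambda>w. int (degY w) = int (degY (FWord [LY])) + d) (D genY)"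
    and le: "words_in (\<lambda>w. int (degY w) \<le> int (degY (FWord [LX])) + d) (D genX)"
      "words_in (\<lambda>w. int (degY w) \<le> int (degY (FWord [LY])) + d) (D genY)"
    by (rule leading_part[OF D, of "\<lambda>w. int (degY w)"]) auto
  have "(\<exists>w\<in>Poly_Mapping.keys (E genX). degX w = 0) \<or> (\<exists>w\<in>Poly_Mapping.keys (E genY). degY w = 0)"
    by (rule weighted_homogeneous_border[OF E, of 1 0 d])
      (auto simp: EX EY words_in_def in_keys_iff lookup_part split: if_splits)
  moreover have "degX w > 0" if "w \<in> Poly_Mapping.keys (E genX)" for w
    using that pure by (auto simp: EX words_in_def in_keys_iff lookup_part split: if_splits)
  ultimately obtain w where "w \<in> Poly_Mapping.keys (E genY)" "degY w = 0"
    by fastforce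
  then have "d = -1"
    by (auto simp: EY in_keys_iff lookup_part split: if_splits)
  have "D genX = 0"
    by (rule words_in_contradictory[OF le(1) le(1)]) (simp add: \<open>d = -1\<close>)
  moreover have "words_in (\<lambda>w. degY w = 0) (D genY)"
    by (rule words_in_mono[OF le(2)]) (simp add: \<open>d = -1\<close>)
  ultimately show ?thesis by (simp add: triangular_def)
qed

section \<open>Values on points and curves\<close>

global_interpretation num: scalar_embedding "\<lambda>c::'k::field. c"
  by unfold_locales (simp_all add: mult.commute)

lemma word_eval_commutative:
  fixes p q :: "'r::comm_ring_1"
  shows "word_eval p q w = p ^ degX w * q ^ degY w"
  by (induction w rule: fword_induct) (simp_all add: word_eval_add algebra_simps)

lemma coeff_subst_monom:
  "coeff (subst (\<lambda>c. [:c:]) (monom a i) (monom b j) f) n =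
    (\<Sum>w\<in>Poly_Mapping.keys f. if i * degX w + j * degY w = n
       then Poly_Mapping.lookup f w * (a ^ degX w * b ^ degY w) else 0)"
  unfolding subst_def extend_def coeff_sum word_eval_commutative
  by (intro sum.cong refl) (simp add: monom_power mult_monom)

lemma poly_subst:
  "poly (subst (\<lambda>c. [:c:]) p q f) z = subst (\<lambda>c. c) (poly p z) (poly q z) f"
  by (simp add: subst_def extend_def poly_sum word_eval_commutative)

lemma (in scalar_embedding) subst_subst_gens:
  "subst \<iota> P Q (subst_gens p q f) = subst \<iota> (subst \<iota> P Q p) (subst \<iota> P Q q) f"
proof (induction f rule: free_alg_induct)
  case zero
  then show ?case by (simp add: subst_linear self.subst_linear)
next
  case (add w c f)
  have "subst \<iota> P Q (word_eval p q w) = word_eval (subst \<iota> P Q p) (subst \<iota> P Q q) w"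
    by (induction w rule: fword_induct) (simp_all add: word_eval_add subst_mult)
  then have "subst \<iota> P Q (subst_gens p q (Poly_Mapping.single w c)) =
      subst \<iota> (subst \<iota> P Q p) (subst \<iota> P Q q) (Poly_Mapping.single w c)"
    by (simp add: self.subst_linear subst_linear flip: scale_def)
  with add show ?case by (simp add: self.subst_linear subst_linear)
qed

section \<open>The flow of a locally nilpotent derivation\<close>

text \<open>
  Pairing the divided powers of \<open>E\<close> with the evaluation at a point yields the Taylor coefficients of
  the integral curve through that point. Local nilpotence makes the curve polynomial, so it is a
  homomorphism \<open>\<Phi>\<close> to polynomials that carries \<open>E\<close> to the ordinary derivative. The hypotheses then
  say that the coordinates \<open>X\<close> and \<open>Y\<close> of the curve satisfy \<open>Y dvd X'\<close> and \<open>X dvd Y'\<close> with nonzero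
  derivatives, so each has smaller degree than the other.
\<close>

lemma no_flow_with_mutual_divisibility:
  fixes E :: "'k::field_char_0 free_alg \<Rightarrow> 'k free_alg"
  assumes E: "derivation E" "locally_nilpotent E"
    and X: "words_in (\<lambda>w. degY w > 0) (E genX)" "subst (\<lambda>c. c) x\<^sub>0 y\<^sub>0 (E genX) \<noteq> 0"
    and Y: "words_in (\<lambda>w. degX w > 0) (E genY)" "subst (\<lambda>c. c) x\<^sub>0 y\<^sub>0 (E genY) \<noteq> 0"
  shows False
proof -
  let ?\<chi> = "subst (\<lambda>c. c) x\<^sub>0 y\<^sub>0"
  define \<Phi> where "\<Phi> p = Abs_poly (\<lambda>n. ?\<chi> (divided_power E n p))" for p
  have coeff: "coeff (\<Phi> p) n = ?\<chi> (divided_power E n p)" for p n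
  proof -
    obtain N where "(E ^^ N) p = 0"
      using E(2) unfolding locally_nilpotent_def by blast
    then have "divided_power E i p = 0" if "i > N" for i
      using funpow_eq_0_mono[OF E(1), of N p i] that by (simp add: divided_power_eq_0_iff)
    then show ?thesis
      unfolding \<Phi>_def by (subst coeff_Abs_poly[of N]) (simp_all add: num.subst_linear)
  qed
  have add: "\<Phi> (p + q) = \<Phi> p + \<Phi> q" and zero: "\<Phi> 0 = 0"
    and scale: "\<Phi> (scale c p) = smult c (\<Phi> p)" for p q c
    by (auto intro!: poly_eqI simp: coeff divided_power_linear[OF E(1)] num.subst_linear)
  have mult: "\<Phi> (p * q) = \<Phi> p * \<Phi> q" for p q
  proof (rule poly_eqI)
    fix n
    have sum: "?\<chi> (sum f A) = (\<Sum>a\<in>A. ?\<chi> (f a))" for f and A :: "nat set"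
      by (induction A rule: infinite_finite_induct) (simp_all add: num.subst_linear)
    show "coeff (\<Phi> (p * q)) n = coeff (\<Phi> p * \<Phi> q) n"
      by (simp add: coeff coeff_mult divided_power_mult[OF E(1)] sum num.subst_mult)
  qed
  have one: "\<Phi> 1 = 1"
  proof (rule poly_eqI)
    fix n
    have "(E ^^ n) 1 = 0" if "n > 0"
      using funpow_eq_0_mono[OF E(1), of 1 1 n] derivationD(5)[OF E(1)] that by simp
    then show "coeff (\<Phi> 1) n = coeff 1 n"
      by (cases n) (simp_all add: coeff divided_power_simps[OF E(1)] divided_power_eq_0_iff[THEN iffD2]
          num.subst_linear)
  qed
  have deriv: "\<Phi> (E p) = pderiv (\<Phi> p)" for p
    by (rule poly_eqI)
      (simp add: coeff coeff_pderiv divided_power_simps[OF E(1)] num.subst_linear del: of_nat_Suc)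
  have word: "\<Phi> (Poly_Mapping.single w 1) = \<Phi> genX ^ degX w * \<Phi> genY ^ degY w" for w
    by (induction w rule: fword_induct) (simp_all add: one single_letter_add mult algebra_simps)
  have dvd: "q dvd \<Phi> p" if "\<And>w. w \<in> Poly_Mapping.keys p \<Longrightarrow> q dvd \<Phi> genX ^ degX w * \<Phi> genY ^ degY w" for p q
  proof -
    have sum: "\<Phi> (sum f A) = (\<Sum>a\<in>A. \<Phi> (f a))" for f and A :: "fword set"
      by (induction A rule: infinite_finite_induct) (simp_all add: add zero)
    have "\<Phi> p = (\<Sum>w\<in>Poly_Mapping.keys p. smult (Poly_Mapping.lookup p w) (\<Phi> genX ^ degX w * \<Phi> genY ^ degY w))"
      by (subst sum_words[of p, symmetric]) (simp only: sum scale word)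
    then show ?thesis using that by (auto intro: dvd_sum dvd_smult)
  qed
  have "\<Phi> genY dvd \<Phi> (E genX)"
    using X(1) by (intro dvd) (auto simp: words_in_def intro!: dvd_mult dvd_power)
  then have 1: "\<Phi> genY dvd pderiv (\<Phi> genX)" by (simp add: deriv)
  have "\<Phi> genX dvd \<Phi> (E genY)"
    using Y(1) by (intro dvd) (auto simp: words_in_def intro!: dvd_mult2 dvd_power)
  then have 2: "\<Phi> genX dvd pderiv (\<Phi> genY)" by (simp add: deriv)
  have "coeff (pderiv (\<Phi> genX)) 0 \<noteq> 0" "coeff (pderiv (\<Phi> genY)) 0 \<noteq> 0"
    using X(2) Y(2) by (simp_all add: coeff divided_power_simps(1)[OF E(1)] flip: deriv)
  then have nz: "pderiv (\<Phi> genX) \<noteq> 0" "pderiv (\<Phi> genY) \<noteq> 0" by auto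
  then have "degree (\<Phi> genX) > 0" "degree (\<Phi> genY) > 0"
    by (metis gr0I pderiv_eq_0_iff)+
  moreover have "degree (\<Phi> genY) \<le> degree (\<Phi> genX) - 1" "degree (\<Phi> genX) \<le> degree (\<Phi> genY) - 1"
    using dvd_imp_degree_le[OF 1 nz(1)] dvd_imp_degree_le[OF 2 nz(2)] by (simp_all add: degree_pderiv)
  ultimately show False by linarith
qed

section \<open>The Newton triangle\<close>

text \<open>
  The coefficients of these two polynomials are the coefficients of \<open>D\<close> on the borders \<open>i = -1\<close>
  and \<open>j = -1\<close> of its Newton polygon.
\<close>

definition y_poly :: "('k::field free_alg \<Rightarrow> 'k free_alg) \<Rightarrow> 'k poly" where
  "y_poly D = subst (\<lambda>c. [:c:]) 0 (monom 1 1) (D genX)"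

definition x_poly :: "('k::field free_alg \<Rightarrow> 'k free_alg) \<Rightarrow> 'k poly" where
  "x_poly D = subst (\<lambda>c. [:c:]) (monom 1 1) 0 (D genY)"

lemma coeff_y_poly: "coeff (y_poly D) j = Poly_Mapping.lookup (D genX) (ypow j)"
proof -
  have "coeff (y_poly D) j = (\<Sum>w\<in>Poly_Mapping.keys (D genX). if w = ypow j
       then Poly_Mapping.lookup (D genX) (ypow j) else 0)"
  proof -
    have "y_poly D = subst (\<lambda>c. [:c:]) (monom 0 0) (monom 1 1) (D genX)"
      by (simp add: y_poly_def)
    then show ?thesis
    proof (simp only: coeff_subst_monom, intro sum.cong refl)
      fix w
      have "w = ypow j \<longleftrightarrow> degX w = 0 \<and> degY w = j" by (rule eq_ypow_iff)
      then show "(if 0 * degX w + 1 * degY w = j then Poly_Mapping.lookup (D genX) w * (0 ^ degX w * 1 ^ degY w) else 0) =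
          (if w = ypow j then Poly_Mapping.lookup (D genX) (ypow j) else 0)"
        by (cases "w = ypow j") (auto simp: power_0_left)
    qed
  qed
  then show ?thesis by (simp add: in_keys_iff)
qed

lemma coeff_x_poly: "coeff (x_poly D) i = Poly_Mapping.lookup (D genY) (xpow i)"
proof -
  have "coeff (x_poly D) i = (\<Sum>w\<in>Poly_Mapping.keys (D genY). if w = xpow i
       then Poly_Mapping.lookup (D genY) (xpow i) else 0)"
  proof -
    have "x_poly D = subst (\<lambda>c. [:c:]) (monom 1 1) (monom 0 0) (D genY)"
      by (simp add: x_poly_def)
    then show ?thesis
    proof (simp only: coeff_subst_monom, intro sum.cong refl)
      fix w
      have "w = xpow i \<longleftrightarrow> degX w = i \<and> degY w = 0" by (rule eq_xpow_iff)
      then show "(if 1 * degX w + 0 * degY w = i then Poly_Mapping.lookup (D genY) w * (1 ^ degX w * 0 ^ degY w) else 0) =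
          (if w = xpow i then Poly_Mapping.lookup (D genY) (xpow i) else 0)"
        by (cases "w = xpow i") (auto simp: power_0_left)
    qed
  qed
  then show ?thesis by (simp add: in_keys_iff)
qed

lemma degX_pos_if_y_poly_eq_0: "y_poly D = 0 \<Longrightarrow> words_in (\<lambda>w. degX w > 0) (D genX)"
  unfolding words_in_def
proof
  fix w assume *: "y_poly D = 0" "w \<in> Poly_Mapping.keys (D genX)"
  then have "w \<noteq> ypow (degY w)"
    using coeff_y_poly[of D "degY w"] by (auto simp: in_keys_iff)
  then show "degX w > 0" by (auto simp: eq_ypow_iff)
qed

text \<open>
  For the weight \<open>(m + 1, n + 1)\<close> the shifts \<open>(-1, m)\<close> and \<open>(n, -1)\<close> have the same weight
  \<open>m n - 1\<close>. The highest shift is attained on a border, where the degrees of the two border polynomials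
  bound it by \<open>m n - 1\<close>.
\<close>

lemma newton_triangle:
  fixes D :: "'k::field_char_0 free_alg \<Rightarrow> 'k free_alg"
  assumes D: "derivation D" "locally_nilpotent D"
    and nz: "y_poly D \<noteq> 0" "x_poly D \<noteq> 0"
    and m: "m = degree (y_poly D)" and n: "n = degree (x_poly D)"
  obtains E where "derivation E" "locally_nilpotent E"
    "E genX = part (\<lambda>w. Suc m * degX w + Suc n * degY w = m * Suc n) (D genX)"
    "E genY = part (\<lambda>w. Suc m * degX w + Suc n * degY w = n * Suc m) (D genY)"
    "words_in (\<lambda>w. Suc m * degX w + Suc n * degY w \<le> m * Suc n) (D genX)"
    "words_in (\<lambda>w. Suc m * degX w + Suc n * degY w \<le> n * Suc m) (D genY)"
proof -
  let ?W = "\<lambda>w. int (Suc m * degX w + Suc n * degY w)"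
  have "D \<noteq> (\<lambda>_. 0)"
    using nz(1) by (auto simp: y_poly_def pol.subst_linear)
  then obtain d E where E: "derivation E" "locally_nilpotent E" "E \<noteq> (\<lambda>_. 0)"
    and EX: "E genX = part (\<lambda>w. ?W w = ?W (FWord [LX]) + d) (D genX)"
    and EY: "E genY = part (\<lambda>w. ?W w = ?W (FWord [LY]) + d) (D genY)"
    and le: "words_in (\<lambda>w. ?W w \<le> ?W (FWord [LX]) + d) (D genX)"
      "words_in (\<lambda>w. ?W w \<le> ?W (FWord [LY]) + d) (D genY)"
    by (rule leading_part[OF D, of ?W]) (auto simp: algebra_simps)
  have "(\<exists>w\<in>Poly_Mapping.keys (E genX). degX w = 0) \<or> (\<exists>w\<in>Poly_Mapping.keys (E genY). degY w = 0)"
    by (rule weighted_homogeneous_border[OF E, of "Suc n" "Suc m" d])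
      (auto simp: EX EY words_in_def in_keys_iff lookup_part split: if_splits)
  then have "d \<le> int m * int n - 1"
  proof (elim disjE bexE)
    fix w assume w: "w \<in> Poly_Mapping.keys (E genX)" "degX w = 0"
    then have "Poly_Mapping.lookup (D genX) w \<noteq> 0" and W: "?W w = ?W (FWord [LX]) + d"
      by (auto simp: EX in_keys_iff lookup_part split: if_splits)
    then have "coeff (y_poly D) (degY w) \<noteq> 0"
      using w(2) eq_ypow_iff[of w "degY w"] by (auto simp: coeff_y_poly)
    then have "degY w \<le> m" unfolding m by (rule le_degree)
    then have "Suc n * degY w \<le> Suc n * m" by (rule mult_le_mono2)
    then have "int (Suc n * degY w) \<le> int (Suc n * m)" by (simp only: of_nat_le_iff)
    with W w(2) show ?thesis by (simp add: algebra_simps)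
  next
    fix w assume w: "w \<in> Poly_Mapping.keys (E genY)" "degY w = 0"
    then have "Poly_Mapping.lookup (D genY) w \<noteq> 0" and W: "?W w = ?W (FWord [LY]) + d"
      by (auto simp: EY in_keys_iff lookup_part split: if_splits)
    then have "coeff (x_poly D) (degX w) \<noteq> 0"
      using w(2) eq_xpow_iff[of w "degX w"] by (auto simp: coeff_x_poly)
    then have "degX w \<le> n" unfolding n by (rule le_degree)
    then have "Suc m * degX w \<le> Suc m * n" by (rule mult_le_mono2)
    then have "int (Suc m * degX w) \<le> int (Suc m * n)" by (simp only: of_nat_le_iff)
    with W w(2) show ?thesis by (simp add: algebra_simps)
  qed
  moreover have "d \<ge> int m * int n - 1"
  proof -
    have "coeff (y_poly D) m \<noteq> 0" unfolding m using nz(1) by simp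
    then have "ypow m \<in> Poly_Mapping.keys (D genX)" by (simp add: coeff_y_poly in_keys_iff)
    then have "?W (ypow m) \<le> ?W (FWord [LX]) + d" using le(1) by (simp add: words_in_def)
    moreover have "degX (ypow m) = 0" "degY (ypow m) = m" using eq_ypow_iff by blast+
    ultimately show ?thesis by (simp add: algebra_simps)
  qed
  ultimately have d: "d = int m * int n - 1" by simp
  have "?W (FWord [LX]) + d = int (m * Suc n)" "?W (FWord [LY]) + d = int (n * Suc m)"
    by (simp_all add: d algebra_simps)
  note EX[unfolded this of_nat_eq_iff] EY[unfolded this of_nat_eq_iff]
    le(1)[unfolded this of_nat_le_iff] le(2)[unfolded this of_nat_le_iff]
  then show thesis using that E(1,2) by blast
qed

lemma Suc_dvd_mult_SucD: "Suc m dvd m * k \<Longrightarrow> Suc m dvd k"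
  using coprime_dvd_mult_right_iff[of "Suc m" m k] by (simp add: coprime_commute)

text \<open>
  On the hypotenuse a pure power \<open>x\<^sup>e\<close> in the image of \<open>x\<close> would give \<open>(m + 1) e = m (n + 1)\<close>,
  hence the divisibility since \<open>m\<close> and \<open>m + 1\<close> are coprime; pure powers of \<open>y\<close> in the image of \<open>y\<close>
  are excluded in the same way. So if divisibility fails, the flow argument applies.
\<close>

lemma newton_triangle_divisibility:
  fixes D :: "'k::field_char_0 free_alg \<Rightarrow> 'k free_alg"
  assumes D: "derivation D" "locally_nilpotent D"
    and nz: "y_poly D \<noteq> 0" "x_poly D \<noteq> 0"
    and m: "m = degree (y_poly D)" and n: "n = degree (x_poly D)" and "m \<le> n"
  shows "Suc m dvd Suc n"
proof (rule ccontr)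
  assume not_dvd: "\<not> Suc m dvd Suc n"
  obtain E where E: "derivation E" "locally_nilpotent E"
    and EX: "E genX = part (\<lambda>w. Suc m * degX w + Suc n * degY w = m * Suc n) (D genX)"
    and EY: "E genY = part (\<lambda>w. Suc m * degX w + Suc n * degY w = n * Suc m) (D genY)"
    by (rule newton_triangle[OF D nz m n])
  have EX_keys: "Suc m * degX w + Suc n * degY w = m * Suc n" if "w \<in> Poly_Mapping.keys (E genX)" for w
    using that by (auto simp: EX in_keys_iff lookup_part simp del: mult_Suc mult_Suc_right split: if_splits)
  have EY_keys: "Suc m * degX w + Suc n * degY w = n * Suc m" if "w \<in> Poly_Mapping.keys (E genY)" for w
    using that by (auto simp: EY in_keys_iff lookup_part simp del: mult_Suc mult_Suc_right split: if_splits)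
  have X: "words_in (\<lambda>w. degY w > 0) (E genX)"
    unfolding words_in_def
  proof (intro ballI gr0I)
    fix w assume "w \<in> Poly_Mapping.keys (E genX)" "degY w = 0"
    with EX_keys[of w] have "m * Suc n = Suc m * degX w" by simp
    then have "Suc m dvd m * Suc n" by (rule dvdI)
    with not_dvd show False by (blast dest: Suc_dvd_mult_SucD)
  qed
  have Y: "words_in (\<lambda>w. degX w > 0) (E genY)"
    unfolding words_in_def
  proof (intro ballI gr0I)
    fix w assume "w \<in> Poly_Mapping.keys (E genY)" "degX w = 0"
    with EY_keys[of w] have "n * Suc m = Suc n * degY w" by simp
    then have "Suc n dvd n * Suc m" by (rule dvdI)
    then have "Suc n dvd Suc m" by (rule Suc_dvd_mult_SucD)
    then have "Suc n \<le> Suc m" by (rule dvd_imp_le) simp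
    with \<open>m \<le> n\<close> not_dvd show False by simp
  qed
  \<comment> \<open>a point (1, z) at which both components of the vector field are nonzero: on the line x = 1
    the terms of the two end points of the hypotenuse cannot cancel\<close>
  let ?a = "subst (\<lambda>c. [:c:]) (monom 1 0) (monom 1 1) (E genX)"
  let ?b = "subst (\<lambda>c. [:c:]) (monom 1 0) (monom 1 1) (E genY)"
  have "coeff ?a m = (\<Sum>w\<in>Poly_Mapping.keys (E genX). if w = ypow m then Poly_Mapping.lookup (E genX) (ypow m) else 0)"
    unfolding coeff_subst_monom
  proof (intro sum.cong refl)
    fix w assume "w \<in> Poly_Mapping.keys (E genX)"
    from EX_keys[OF this] have "degY w = m \<longleftrightarrow> w = ypow m"
      unfolding eq_ypow_iff by (auto simp: mult.commute[of m])
    then show "(if 0 * degX w + 1 * degY w = m then Poly_Mapping.lookup (E genX) w * (1 ^ degX w * 1 ^ degY w) else 0) =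
        (if w = ypow m then Poly_Mapping.lookup (E genX) (ypow m) else 0)"
      by auto
  qed
  also have "\<dots> = Poly_Mapping.lookup (E genX) (ypow m)"
    by (simp add: in_keys_iff)
  also have "\<dots> = Poly_Mapping.lookup (D genX) (ypow m)"
  proof -
    have "degX (ypow m) = 0" "degY (ypow m) = m" using eq_ypow_iff by blast+
    then show ?thesis by (simp add: EX lookup_part mult.commute)
  qed
  also have "\<dots> \<noteq> 0" unfolding coeff_y_poly[symmetric] m using nz(1) by simp
  finally have a: "?a \<noteq> 0" by auto
  have "coeff ?b 0 = (\<Sum>w\<in>Poly_Mapping.keys (E genY). if w = xpow n then Poly_Mapping.lookup (E genY) (xpow n) else 0)"
    unfolding coeff_subst_monom
  proof (intro sum.cong refl)
    fix w assume "w \<in> Poly_Mapping.keys (E genY)"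
    from EY_keys[OF this] have "degX w = n" if "degY w = 0"
      using that by (metis add_0_right mult.commute mult_0_right mult_cancel1 nat.distinct(1))
    then have "degY w = 0 \<longleftrightarrow> w = xpow n"
      unfolding eq_xpow_iff by blast
    then show "(if 0 * degX w + 1 * degY w = 0 then Poly_Mapping.lookup (E genY) w * (1 ^ degX w * 1 ^ degY w) else 0) =
        (if w = xpow n then Poly_Mapping.lookup (E genY) (xpow n) else 0)"
      by auto
  qed
  also have "\<dots> = Poly_Mapping.lookup (E genY) (xpow n)"
    by (simp add: in_keys_iff)
  also have "\<dots> = Poly_Mapping.lookup (D genY) (xpow n)"
  proof -
    have "degX (xpow n) = n" "degY (xpow n) = 0" using eq_xpow_iff by blast+
    then show ?thesis by (simp add: EY lookup_part mult.commute)
  qed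
  also have "\<dots> \<noteq> 0" unfolding coeff_x_poly[symmetric] n using nz(2) by simp
  finally have "?b \<noteq> 0" by auto
  with a have "finite {z. poly (?a * ?b) z = 0}" by (intro poly_roots_finite) simp
  then obtain z where "poly (?a * ?b) z \<noteq> 0"
    using infinite_UNIV_char_0 by (metis (mono_tags, lifting) UNIV_eq_I mem_Collect_eq)
  then have "subst (\<lambda>c. c) 1 z (E genX) \<noteq> 0" "subst (\<lambda>c. c) 1 z (E genY) \<noteq> 0"
    by (auto simp: poly_subst poly_monom)
  with no_flow_with_mutual_divisibility[OF E X _ Y] show False by blast
qed

section \<open>Reduction to triangular form\<close>

definition shear :: "'k::field \<Rightarrow> nat \<Rightarrow> 'k free_alg \<Rightarrow> 'k free_alg" where
  "shear c k = subst_gens genX (genY + scale c (genX ^ k))"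

definition swap_gens :: "'k::field free_alg \<Rightarrow> 'k free_alg" where
  "swap_gens = subst_gens genY genX"

lemma shear_gens [simp]: "shear c k genX = genX" "shear c k genY = genY + scale c (genX ^ k)"
  by (simp_all add: shear_def)

lemma swap_gens_gens [simp]: "swap_gens genX = genY" "swap_gens genY = genX"
  by (simp_all add: swap_gens_def)

lemma algebra_endo_shear: "algebra_endo (shear c k)"
  by (simp add: shear_def algebra_endo_subst)

lemma algebra_automorphism_shear: "algebra_automorphism (shear c k)"
  and inv_shear: "inv (shear c k) = shear (- c) k"
proof -
  have "scale c p + scale (- c) p = 0" for c and p :: "'a free_alg"
    by (intro poly_mapping_eqI) (simp add: lookup_scale lookup_add)
  then have *: "shear c k (shear (- c) k genY) = genY" for c :: 'a
    by (simp add: algebra_endoD[OF algebra_endo_shear] add.assoc)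
  show "algebra_automorphism (shear c k)" "inv (shear c k) = shear (- c) k"
    using algebra_automorphismI[OF algebra_endo_shear algebra_endo_shear, of c k "- c" k]
      *[of c] *[of "- c"] by simp_all
qed

lemma algebra_automorphism_swap: "algebra_automorphism swap_gens"
  and inv_swap: "inv swap_gens = swap_gens"
  using algebra_automorphismI[of swap_gens swap_gens]
  by (simp_all add: swap_gens_def algebra_endo_subst)

definition triangularizable :: "('k::field free_alg \<Rightarrow> 'k free_alg) \<Rightarrow> bool" where
  "triangularizable D \<longleftrightarrow> (\<exists>\<theta>. algebra_automorphism \<theta> \<and> triangular (inv \<theta> \<circ> D \<circ> \<theta>))"

lemma triangularizable_if_conj:
  assumes "algebra_automorphism \<rho>" "triangularizable (inv \<rho> \<circ> D \<circ> \<rho>)"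
  shows "triangularizable D"
proof -
  obtain \<theta> where \<theta>: "algebra_automorphism \<theta>" "triangular (inv \<theta> \<circ> (inv \<rho> \<circ> D \<circ> \<rho>) \<circ> \<theta>)"
    using assms(2) by (auto simp: triangularizable_def)
  have "inv (\<rho> \<circ> \<theta>) = inv \<theta> \<circ> inv \<rho>"
    using assms(1) \<theta>(1) by (auto simp: algebra_automorphism_iff intro: o_inv_distrib)
  with \<theta>(2) have "triangular (inv (\<rho> \<circ> \<theta>) \<circ> D \<circ> (\<rho> \<circ> \<theta>))"
    by (simp add: comp_assoc)
  with algebra_automorphism_comp[OF assms(1) \<theta>(1)] show ?thesis
    by (auto simp: triangularizable_def)
qed

lemma triangularizable_if_y_poly_eq_0:
  fixes D :: "'k::field_char_0 free_alg \<Rightarrow> 'k free_alg"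
  assumes "derivation D" "locally_nilpotent D" "y_poly D = 0"
  shows "triangularizable D"
proof (cases "D = (\<lambda>_. 0)")
  case True
  then have "triangular D" by (simp add: triangular_def)
  then show ?thesis
    unfolding triangularizable_def
    by (intro exI[of _ id]) (simp add: algebra_automorphism_iff algebra_endo_id)
next
  case False
  then have "triangular D"
    using assms by (intro triangular_if_no_pure_y_words degX_pos_if_y_poly_eq_0)
  then show ?thesis
    unfolding triangularizable_def
    by (intro exI[of _ id]) (simp add: algebra_automorphism_iff algebra_endo_id)
qed

lemma polys_conj_swap:
  "y_poly (inv swap_gens \<circ> D \<circ> swap_gens) = x_poly D"
  "x_poly (inv swap_gens \<circ> D \<circ> swap_gens) = y_poly D"
proof -
  have "subst (\<lambda>c. [:c:]) p q (swap_gens f) = subst (\<lambda>c. [:c:]) q p f" for p q and f :: "'a free_alg"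
    by (simp add: swap_gens_def pol.subst_subst_gens)
  then show "y_poly (inv swap_gens \<circ> D \<circ> swap_gens) = x_poly D"
    "x_poly (inv swap_gens \<circ> D \<circ> swap_gens) = y_poly D"
    by (simp_all add: y_poly_def x_poly_def inv_swap)
qed

lemma pol_subst_power: "subst (\<lambda>c. [:c:]) P Q (f ^ k) = subst (\<lambda>c. [:c:]) P Q f ^ k"
  by (induction k) (simp_all add: pol.subst_mult)

lemma pol_subst_derivation_power:
  assumes D: "derivation D"
  shows "subst (\<lambda>c. [:c:]) P Q (D (f ^ k)) =
    of_nat k * subst (\<lambda>c. [:c:]) P Q f ^ (k - 1) * subst (\<lambda>c. [:c:]) P Q (D f)"
proof (induction k)
  case 0
  then show ?case by (simp add: derivationD[OF D] pol.subst_linear)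
next
  case (Suc k)
  then show ?case
    by (cases k) (simp_all add: derivationD[OF D] pol.subst_linear pol.subst_mult pol_subst_power algebra_simps)
qed

text \<open>
  The shear fixes the line \<open>x = 0\<close> pointwise and fixes the generator \<open>x\<close>.
\<close>

lemma y_poly_conj_shear:
  assumes "k > 0"
  shows "y_poly (inv (shear c k) \<circ> D \<circ> shear c k) = y_poly D"
proof -
  have "subst (\<lambda>c. [:c:]) 0 (monom 1 1) (shear (- c) k f) = subst (\<lambda>c. [:c:]) 0 (monom 1 1) f" for f
    using assms by (simp add: shear_def pol.subst_subst_gens pol.subst_linear pol_subst_power power_0_left)
  then show ?thesis by (simp add: y_poly_def inv_shear)
qed

text \<open>
  Pulling back along the shear replaces the line \<open>y = 0\<close> by the curve \<open>y = - c x\<^sup>k\<close>; the second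
  summand comes from \<open>D (x\<^sup>k)\<close>.
\<close>

lemma x_poly_conj_shear:
  assumes D: "derivation D"
  shows "x_poly (inv (shear c k) \<circ> D \<circ> shear c k) =
    subst (\<lambda>c. [:c:]) (monom 1 1) (monom (- c) k) (D genY) +
    monom (of_nat k * c) (k - 1) * subst (\<lambda>c. [:c:]) (monom 1 1) (monom (- c) k) (D genX)"
proof -
  have "subst (\<lambda>c. [:c:]) (monom 1 1) 0 (shear (- c) k f) =
      subst (\<lambda>c. [:c:]) (monom 1 1) (monom (- c) k) f" for f
    by (simp add: shear_def pol.subst_subst_gens pol.subst_linear pol_subst_power monom_power smult_monom)
  moreover have "[:c:] * (of_nat k * monom 1 1 ^ (k - 1) * p) = monom (of_nat k * c) (k - 1) * p" for p
  proof -
    have "[:c:] * (of_nat k * monom 1 1 ^ (k - 1)) = monom (of_nat k * c) (k - 1)"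
      by (simp add: monom_power of_nat_poly smult_monom mult.commute)
    then show ?thesis by (metis mult.assoc)
  qed
  ultimately show ?thesis
    by (simp add: x_poly_def inv_shear derivationD[OF D] pol.subst_linear pol_subst_derivation_power[OF D])
qed

text \<open>
  The coefficient of \<open>t\<^sup>N\<close> in \<open>f (t, - c t\<^sup>k)\<close>, as a polynomial in \<open>c\<close>.
\<close>

definition specialized_coeff :: "nat \<Rightarrow> nat \<Rightarrow> 'k::field free_alg \<Rightarrow> 'k poly" where
  "specialized_coeff k N f = (\<Sum>w\<in>Poly_Mapping.keys f. if degX w + k * degY w = N
     then monom (Poly_Mapping.lookup f w * (- 1) ^ degY w) (degY w) else 0)"

lemma poly_specialized_coeff:
  "poly (specialized_coeff k N f) c = coeff (subst (\<lambda>c. [:c:]) (monom 1 1) (monom (- c) k) f) N"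
  unfolding specialized_coeff_def coeff_subst_monom poly_sum
proof (intro sum.cong refl)
  fix w
  have "(- c) ^ degY w = (- 1) ^ degY w * c ^ degY w" by (rule power_minus)
  then show "poly (if degX w + k * degY w = N then monom (Poly_Mapping.lookup f w * (- 1) ^ degY w) (degY w) else 0) c =
      (if 1 * degX w + k * degY w = N then Poly_Mapping.lookup f w * (1 ^ degX w * (- c) ^ degY w) else 0)"
    by (simp add: poly_monom)
qed

lemma coeff_specialized_coeff:
  "coeff (specialized_coeff k N f) s =
    (\<Sum>w\<in>Poly_Mapping.keys f. if degX w + k * degY w = N \<and> degY w = s
       then Poly_Mapping.lookup f w * (- 1) ^ s else 0)"
  unfolding specialized_coeff_def coeff_sum
  by (intro sum.cong) auto

lemma coeff_subst_monom_eq_0: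
  assumes "words_in (\<lambda>w. degX w + k * degY w \<le> N) f" "M > N"
  shows "coeff (subst (\<lambda>c. [:c:]) (monom 1 1) (monom a k) f) M = 0"
  unfolding coeff_subst_monom
  by (rule sum.neutral) (use assms in \<open>auto simp: words_in_def\<close>)

text \<open>
  After the shear, the coefficient of \<open>x\<^sup>n\<close> in the border polynomial is a polynomial \<open>\<Gamma>\<close> in \<open>c\<close>, and
  the triangle still bounds the degree by \<open>n\<close>. The term of \<open>\<Gamma>\<close> of degree \<open>m + 1\<close> stems from \<open>y\<^sup>m\<close> in
  \<open>D x\<close> only, so \<open>\<Gamma>\<close> is not constant and has a root over an algebraically closed field.
\<close>

lemma shear_reduces_x_poly:
  fixes D :: "'k::{alg_closed_field, field_char_0} free_alg \<Rightarrow> 'k free_alg"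
  assumes D: "derivation D" "locally_nilpotent D"
    and nz: "y_poly D \<noteq> 0" "x_poly D \<noteq> 0"
    and le: "degree (y_poly D) \<le> degree (x_poly D)"
  obtains c k where "k > 0"
    "x_poly (inv (shear c k) \<circ> D \<circ> shear c k) = 0 \<or>
     degree (x_poly (inv (shear c k) \<circ> D \<circ> shear c k)) < degree (x_poly D)"
proof -
  define m n where "m = degree (y_poly D)" and "n = degree (x_poly D)"
  obtain k where k: "Suc n = Suc m * k"
    using newton_triangle_divisibility[OF D nz m_def n_def] le by (auto simp: m_def n_def elim: dvdE)
  then have "k > 0" by (cases k) auto
  have n: "n = m * k + (k - 1)" using k \<open>k > 0\<close> by simp
  obtain E where
    "words_in (\<lambda>w. Suc m * degX w + Suc n * degY w \<le> m * Suc n) (D genX)"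
    "words_in (\<lambda>w. Suc m * degX w + Suc n * degY w \<le> n * Suc m) (D genY)"
    by (rule newton_triangle[OF D nz m_def n_def])
  then have wX: "words_in (\<lambda>w. degX w + k * degY w \<le> m * k) (D genX)"
    and wY: "words_in (\<lambda>w. degX w + k * degY w \<le> n) (D genY)"
  proof -
    have "Suc m * degX w + Suc n * degY w = Suc m * (degX w + k * degY w)" for w
      unfolding k by (simp only: distrib_left mult.assoc)
    moreover have "m * Suc n = Suc m * (m * k)" "n * Suc m = Suc m * n"
      unfolding k by (simp_all only: mult_ac)
    ultimately show "words_in (\<lambda>w. Suc m * degX w + Suc n * degY w \<le> m * Suc n) (D genX) \<Longrightarrow>
        words_in (\<lambda>w. degX w + k * degY w \<le> m * k) (D genX)"
      "words_in (\<lambda>w. Suc m * degX w + Suc n * degY w \<le> n * Suc m) (D genY) \<Longrightarrow>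
        words_in (\<lambda>w. degX w + k * degY w \<le> n) (D genY)"
      by (simp_all only: mult_le_cancel1) simp_all
  qed
  define \<Gamma> where "\<Gamma> = specialized_coeff k n (D genY) + monom (of_nat k) 1 * specialized_coeff k (m * k) (D genX)"
  let ?x = "\<lambda>c. x_poly (inv (shear c k) \<circ> D \<circ> shear c k)"
  have "k - 1 \<le> n" "n - (k - 1) = m * k" using n by simp_all
  then have coeff_n: "coeff (?x c) n = poly \<Gamma> c" for c
    by (simp add: x_poly_conj_shear[OF D(1)] \<Gamma>_def poly_specialized_coeff coeff_monom_mult poly_monom mult_ac)
  have degree_le: "degree (?x c) \<le> n" for c
  proof (rule degree_le, intro allI impI)
    fix N assume "n < N"
    moreover from this have "N - (k - 1) > m * k" using n by linarith
    ultimately show "coeff (?x c) N = 0"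
      using coeff_subst_monom_eq_0[OF wX] coeff_subst_monom_eq_0[OF wY]
      by (simp add: x_poly_conj_shear[OF D(1)] coeff_monom_mult)
  qed
  have "coeff \<Gamma> (Suc m) = of_nat k * ((- 1) ^ m * coeff (y_poly D) m)"
  proof -
    \<comment> \<open>a word with m + 1 letters y has weight at least k (m + 1) = n + 1\<close>
    have "degX w + k * degY w \<noteq> n \<or> degY w \<noteq> Suc m" for w
      using k by (auto simp: mult.commute[of k])
    then have "coeff (specialized_coeff k n (D genY)) (Suc m) = 0"
      unfolding coeff_specialized_coeff by (intro sum.neutral) auto
    moreover have "coeff (specialized_coeff k (m * k) (D genX)) m =
        (\<Sum>w\<in>Poly_Mapping.keys (D genX). if w = ypow m then Poly_Mapping.lookup (D genX) (ypow m) * (- 1) ^ m else 0)"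
      unfolding coeff_specialized_coeff
    proof (intro sum.cong refl)
      fix w
      have "degX w + k * degY w = m * k \<and> degY w = m \<longleftrightarrow> w = ypow m"
        unfolding eq_ypow_iff by (auto simp: mult.commute)
      then show "(if degX w + k * degY w = m * k \<and> degY w = m then Poly_Mapping.lookup (D genX) w * (- 1) ^ m else 0) =
          (if w = ypow m then Poly_Mapping.lookup (D genX) (ypow m) * (- 1) ^ m else 0)"
        by auto
    qed
    then have "coeff (specialized_coeff k (m * k) (D genX)) m = (- 1) ^ m * coeff (y_poly D) m"
      by (simp add: coeff_y_poly in_keys_iff)
    ultimately show ?thesis by (simp add: \<Gamma>_def coeff_monom_mult)
  qed
  also have "\<dots> \<noteq> 0" using \<open>k > 0\<close> nz(1) by (simp add: m_def)
  finally have "degree \<Gamma> > 0" using le_degree[of \<Gamma> "Suc m"] by simp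
  then obtain c where c: "poly \<Gamma> c = 0" using alg_closed_imp_poly_has_root by blast
  have "?x c = 0 \<or> degree (?x c) < n"
    using degree_le[of c] coeff_n[of c] c by (metis leading_coeff_0_iff le_neq_implies_less)
  with \<open>k > 0\<close> show thesis using that unfolding n_def by blast
qed

text \<open>
  Exchanging the generators exchanges the two border polynomials, so the one of larger degree may be
  taken to be \<open>x_poly\<close>; a shear then lowers its degree and leaves \<open>y_poly\<close> unchanged.
\<close>

theorem locally_nilpotent_triangularizable:
  fixes D :: "'k::{alg_closed_field, field_char_0} free_alg \<Rightarrow> 'k free_alg"
  assumes "derivation D" "locally_nilpotent D"
  shows "triangularizable D"
  using assms
proof (induction "degree (y_poly D) + degree (x_poly D)" arbitrary: D rule: less_induct)
  case less
  have x0: "triangularizable F" if "derivation F" "locally_nilpotent F" "x_poly F = 0"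
    for F :: "'k free_alg \<Rightarrow> 'k free_alg"
  proof (rule triangularizable_if_conj[OF algebra_automorphism_swap])
    show "triangularizable (inv swap_gens \<circ> F \<circ> swap_gens)"
      using that
      by (intro triangularizable_if_y_poly_eq_0 derivation_conj locally_nilpotent_conj
          algebra_automorphism_swap) (simp_all add: polys_conj_swap)
  qed
  have step: "triangularizable F"
    if F: "derivation F" "locally_nilpotent F"
      and deg: "degree (y_poly F) + degree (x_poly F) = degree (y_poly D) + degree (x_poly D)"
        "degree (y_poly F) \<le> degree (x_poly F)"
    for F :: "'k free_alg \<Rightarrow> 'k free_alg"
  proof (cases "y_poly F = 0 \<or> x_poly F = 0")
    case True
    then show ?thesis using triangularizable_if_y_poly_eq_0 x0 F by blast
  next
    case False
    then obtain c k where k: "k > 0" and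
      red: "x_poly (inv (shear c k) \<circ> F \<circ> shear c k) = 0 \<or>
        degree (x_poly (inv (shear c k) \<circ> F \<circ> shear c k)) < degree (x_poly F)"
      using shear_reduces_x_poly[OF F _ _ deg(2)] by blast
    let ?G = "inv (shear c k) \<circ> F \<circ> shear c k"
    have G: "derivation ?G" "locally_nilpotent ?G"
      using F by (auto intro: derivation_conj locally_nilpotent_conj algebra_automorphism_shear)
    have "triangularizable ?G"
      using red
    proof
      assume "degree (x_poly ?G) < degree (x_poly F)"
      then show ?thesis
        using deg(1) y_poly_conj_shear[OF k, of c F] by (intro less.hyps G) simp
    qed (use x0 G in blast)
    then show ?thesis by (rule triangularizable_if_conj[OF algebra_automorphism_shear])
  qed
  show ?case
  proof (cases "degree (y_poly D) \<le> degree (x_poly D)")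
    case True
    then show ?thesis using step less.prems by blast
  next
    case False
    have "triangularizable (inv swap_gens \<circ> D \<circ> swap_gens)"
      using less.prems False
      by (intro step derivation_conj locally_nilpotent_conj algebra_automorphism_swap)
        (simp_all add: polys_conj_swap)
    then show ?thesis by (rule triangularizable_if_conj[OF algebra_automorphism_swap])
  qed
qed

section \<open>Degrees of automorphisms\<close>

lemma total_deg_le_iff: "total_deg p \<le> d \<longleftrightarrow> words_in (\<lambda>w. length (letters w) \<le> d) p"
  by (simp add: total_deg_def words_in_def)

lemma total_deg_endo_le:
  assumes "algebra_endo \<rho>"
  shows "total_deg (\<rho> p) \<le> aut_deg \<rho> * total_deg p"
proof -
  let ?a = "aut_deg \<rho>"
  have gens: "words_in (\<lambda>w. length (letters w) \<le> ?a) (\<rho> genX)"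
    "words_in (\<lambda>w. length (letters w) \<le> ?a) (\<rho> genY)"
    unfolding total_deg_le_iff[symmetric] by (simp_all add: aut_deg_def)
  have word: "words_in (\<lambda>v. length (letters v) \<le> ?a * length (letters w)) (\<rho> (Poly_Mapping.single w 1))" for w
  proof (induction w rule: fword_induct)
    case empty
    show ?case by (simp add: algebra_endoD[OF assms] words_in_def length_letters)
  next
    case (LX w)
    show ?case
      unfolding single_letter_add algebra_endoD(3)[OF assms]
      by (rule words_in_mult[OF gens(1) LX]) (simp add: plus_fword_def)
  next
    case (LY w)
    show ?case
      unfolding single_letter_add algebra_endoD(3)[OF assms]
      by (rule words_in_mult[OF gens(2) LY]) (simp add: plus_fword_def)
  qed
  have p: "words_in (\<lambda>w. length (letters w) \<le> total_deg p) p"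
    unfolding total_deg_le_iff[symmetric] by simp
  have sum: "\<rho> (sum f A) = (\<Sum>a\<in>A. \<rho> (f a))" for f and A :: "fword set"
    by (induction A rule: infinite_finite_induct) (simp_all add: algebra_endoD[OF assms])
  have "\<rho> p = (\<Sum>w\<in>Poly_Mapping.keys p. scale (Poly_Mapping.lookup p w) (\<rho> (Poly_Mapping.single w 1)))"
    by (subst sum_words[of p, symmetric]) (simp only: sum algebra_endoD(2)[OF assms])
  moreover have "words_in (\<lambda>v. length (letters v) \<le> ?a * total_deg p) (\<rho> (Poly_Mapping.single w 1))"
    if "w \<in> Poly_Mapping.keys p" for w
  proof (rule words_in_mono[OF word])
    have "?a * length (letters w) \<le> ?a * total_deg p"
      using p that by (intro mult_le_mono2) (simp add: words_in_def)
    then show "length (letters v) \<le> ?a * total_deg p" if "length (letters v) \<le> ?a * length (letters w)" for v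
      using that by (rule order_trans[rotated])
  qed
  ultimately show ?thesis
    by (simp add: total_deg_le_iff words_in_sum words_in_scale)
qed

lemma aut_deg_comp_le:
  assumes "algebra_endo \<rho>"
  shows "aut_deg (\<rho> \<circ> \<sigma>) \<le> aut_deg \<rho> * aut_deg \<sigma>"
proof -
  have "total_deg (\<rho> (\<sigma> g)) \<le> aut_deg \<rho> * aut_deg \<sigma>" if "g \<in> {genX, genY}" for g
  proof -
    have "aut_deg \<rho> * total_deg (\<sigma> g) \<le> aut_deg \<rho> * aut_deg \<sigma>"
      using that by (intro mult_le_mono2) (auto simp: aut_deg_def)
    with total_deg_endo_le[OF assms] show ?thesis by (rule order_trans)
  qed
  then show ?thesis by (simp add: aut_deg_def[of "\<rho> \<circ> \<sigma>"])
qed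

lemma aut_deg_shear:
  shows "aut_deg (shear 1 N :: 'k::field free_alg \<Rightarrow> 'k free_alg) \<ge> N"
proof -
  have pow: "genX ^ N = (Poly_Mapping.single (xpow N) 1 :: 'k free_alg)"
  proof (induction N)
    case 0
    have "Poly_Mapping.single (FWord []) 1 = (1 :: 'k free_alg)"
      by (metis zero_fword_def single_one)
    then show ?case by simp
  next
    case (Suc N)
    then show ?case by (simp add: genX_def mult_single plus_fword_def)
  qed
  have "xpow N \<noteq> FWord [LY]"
    by (cases N) auto
  then have "xpow N \<in> Poly_Mapping.keys (shear 1 N genY :: 'k free_alg)"
    unfolding shear_gens pow by (simp add: in_keys_iff lookup_add genY_def lookup_single)
  moreover have "words_in (\<lambda>w. length (letters w) \<le> total_deg p) p" for p :: "'k free_alg"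
    unfolding total_deg_le_iff[symmetric] by simp
  ultimately have "N \<le> total_deg (shear 1 N genY :: 'k free_alg)"
    unfolding words_in_def by fastforce
  then show ?thesis by (simp add: aut_deg_def)
qed

lemma shear_fixes_x_words:
  assumes "words_in (\<lambda>w. degY w = 0) p"
  shows "shear c N p = p"
proof -
  have "shear c N (Poly_Mapping.single w 1) = Poly_Mapping.single w 1" if "degY w = 0" for w
    using that by (induction w rule: fword_induct)
      (simp_all add: single_letter_add algebra_endoD[OF algebra_endo_shear])
  moreover have "shear c N (sum f A) = (\<Sum>a\<in>A. shear c N (f a))" for f and A :: "fword set"
    by (induction A rule: infinite_finite_induct) (simp_all add: algebra_endoD[OF algebra_endo_shear])
  ultimately have "shear c N (\<Sum>w\<in>Poly_Mapping.keys p. scale (Poly_Mapping.lookup p w) (Poly_Mapping.single w 1)) =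
      (\<Sum>w\<in>Poly_Mapping.keys p. scale (Poly_Mapping.lookup p w) (Poly_Mapping.single w 1))"
    using assms by (simp add: algebra_endoD(2)[OF algebra_endo_shear] words_in_def)
  then show ?thesis by (simp only: sum_words)
qed

text \<open>
  Conjugating \<open>E\<close> by the shear changes neither value at the generators: \<open>E\<close> kills \<open>x\<^sup>N\<close>, and the shear
  fixes \<open>E y\<close>, a polynomial in \<open>x\<close>.
\<close>

lemma shear_commutes_with_triangular:
  fixes E :: "'k::field free_alg \<Rightarrow> 'k free_alg"
  assumes E: "derivation E" "triangular E"
  shows "shear c N \<circ> E = E \<circ> shear c N"
proof -
  have EX: "E genX = 0" and EY: "words_in (\<lambda>w. degY w = 0) (E genY)"
    using E(2) by (auto simp: triangular_def)
  have "E (genX ^ N) = 0"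
    by (induction N) (simp_all add: derivationD[OF E(1)] EX)
  then have "inv (shear c N) \<circ> E \<circ> shear c N = E"
    by (intro derivation_eqI derivation_conj algebra_automorphism_shear E)
      (simp_all add: EX inv_shear derivationD[OF E(1)] shear_fixes_x_words[OF EY]
        algebra_endoD(5)[OF algebra_endo_shear])
  moreover have "shear c N \<circ> inv (shear c N) = id"
    by (rule algebra_automorphism_cancel[OF algebra_automorphism_shear])
  ultimately show ?thesis by (metis comp_assoc id_comp)
qed

theorem proposition26:
  fixes D :: "'k::{alg_closed_field, field_char_0} free_alg \<Rightarrow> 'k free_alg"
  assumes "derivation D"
    and "locally_nilpotent D"
    and "D \<noteq> (\<lambda>_. 0)"
  shows "\<forall>d\<ge>1. \<exists>\<rho>\<in>Aut_D D. aut_deg \<rho> \<ge> d"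
proof (intro allI impI)
  fix d :: nat
  obtain \<theta> where \<theta>: "algebra_automorphism \<theta>" and tri: "triangular (inv \<theta> \<circ> D \<circ> \<theta>)"
    using locally_nilpotent_triangularizable[OF assms(1,2)] by (auto simp: triangularizable_def)
  have [simp]: "\<theta> \<circ> inv \<theta> = id" "inv \<theta> \<circ> \<theta> = id"
    by (rule algebra_automorphism_cancel[OF \<theta>])+
  \<comment> \<open>if the conjugate had degree less than d, then conjugating it back
    would bound the degree of the shear by N - 1\<close>
  define N where "N = Suc (aut_deg (inv \<theta>) * (d * aut_deg \<theta>))"
  let ?\<sigma> = "shear 1 N :: 'k free_alg \<Rightarrow> 'k free_alg"
  define \<rho> where "\<rho> = \<theta> \<circ> ?\<sigma> \<circ> inv \<theta>"
  have aut: "algebra_automorphism \<rho>"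
    unfolding \<rho>_def by (intro algebra_automorphism_comp \<theta> algebra_automorphism_shear algebra_automorphism_inv)
  have comm: "?\<sigma> \<circ> (inv \<theta> \<circ> D \<circ> \<theta>) = (inv \<theta> \<circ> D \<circ> \<theta>) \<circ> ?\<sigma>"
    by (rule shear_commutes_with_triangular[OF derivation_conj[OF \<theta> assms(1)] tri])
  have "\<rho> \<circ> D = \<theta> \<circ> (?\<sigma> \<circ> (inv \<theta> \<circ> D \<circ> \<theta>)) \<circ> inv \<theta>"
    by (simp add: \<rho>_def comp_assoc)
  also have "\<dots> = \<theta> \<circ> inv \<theta> \<circ> D \<circ> \<rho>"
    unfolding comm by (simp only: \<rho>_def comp_assoc)
  finally have "\<rho> \<circ> D = D \<circ> \<rho>" by simp
  with aut have "\<rho> \<in> Aut_D D" by (simp add: Aut_D_def)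
  moreover have "d \<le> aut_deg \<rho>"
  proof (rule ccontr)
    assume "\<not> d \<le> aut_deg \<rho>"
    have "N \<le> aut_deg ?\<sigma>"
      by (rule aut_deg_shear)
    also have "?\<sigma> = inv \<theta> \<circ> (\<rho> \<circ> \<theta>)"
      by (simp add: \<rho>_def comp_assoc) (simp flip: comp_assoc)
    also have "aut_deg \<dots> \<le> aut_deg (inv \<theta>) * aut_deg (\<rho> \<circ> \<theta>)"
      using algebra_automorphism_inv[OF \<theta>] by (intro aut_deg_comp_le) (simp add: algebra_automorphism_iff)
    also have "\<dots> \<le> aut_deg (inv \<theta>) * (aut_deg \<rho> * aut_deg \<theta>)"
      using aut by (intro mult_le_mono2 aut_deg_comp_le) (simp add: algebra_automorphism_iff)
    also have "\<dots> \<le> aut_deg (inv \<theta>) * (d * aut_deg \<theta>)"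
      using \<open>\<not> d \<le> aut_deg \<rho>\<close> by (intro mult_le_mono2 mult_le_mono1) simp
    finally show False by (simp add: N_def)
  qed
  ultimately show "\<exists>\<rho>\<in>Aut_D D. d \<le> aut_deg \<rho>" by blast
qed

end
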